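(* For every $n\ge 2$, the pure virtual braid group $VP_n$ has a presentation with generators $\mu_{rs}$, $1\le r\neq s\le n$, and relations $$\mu_{ij}\mu_{ik}\mu_{jk}=\mu_{jk}\mu_{ik}\mu_{ij}\quad\text{for all distinct } i,j,k,$$ $$\mu_{ij}\mu_{kl}=\mu_{kl}\mu_{ij}\quad\text{whenever } \{i,j\}\cap\{k,l\}=\emptyset,$$ where the generators $\mu_{rs}$ are the connecting strings in $VB_n$.
   Context: The virtual braid group $VB_n$ is the group with generators $\sigma_1,\dots,\sigma_{n-1},v_1,\dots,v_{n-1}$ and relations (for all indices for which they make sense): (B1) $\sigma_i\sigma_{i+1}\sigma_i=\sigma_{i+1}\sigma_i\sigma_{i+1}$; (B2) $\sigma_i\sigma_j=\sigma_j\sigma_i$ for $|i-j|>1$; (S1) $v_iv_{i+1}v_i=v_{i+1}v_iv_{i+1}$; (S2) $v_iv_j=v_jv_i$ for $|i-j|>1$; (S3) $v_i^2=1$; (M1) $v_i\sigma_{i+1}v_i=v_{i+1}\sigma_iv_{i+1}$; (M2) $\sigma_iv_j=v_j\sigma_i$ for $|i-j|>1$. The pure virtual braid group $VP_n$ is the kernel of the surjective homomorphism $\pi:VB_n\to S_n$ sending both $\sigma_i$ and $v_i$ to the transposition $(i,i+1)$. Connecting strings in $VB_n$: $\mu_{i,i+1}:=\sigma_iv_i$; for $i<j$, $\mu_{ij}:=v_{j-1}v_{j-2}\cdots v_{i+1}\,\mu_{i,i+1}\,v_{i+1}\cdots v_{j-2}v_{j-1}$; for $i<j$, $\mu_{ji}:=t_{ij}\mu_{ij}t_{ij}$,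 where $t_{ij}=v_iv_{i+1}\cdots v_{j-2}v_{j-1}v_{j-2}\cdots v_{i+1}v_i$ is the word representing the transposition $(i\,j)$ (so $\mu_{i+1,i}=v_i\sigma_i$). *)

theory Defs
  imports "HOL-Algebra.Sym_Groups"
begin

section \<open>Groups given by generators and relations\<close>

text \<open>The letter \<open>(x, True)\<close> stands for the generator \<open>x\<close> and \<open>(x, False)\<close> for its
  formal inverse. The pair \<open>(u, v)\<close> stands for the relation \<open>u = v\<close>.\<close>

type_synonym 'a gword = "('a \<times> bool) list"

definition gwords :: "'a set \<Rightarrow> 'a gword set" where
  "gwords X = lists (X \<times> UNIV)"

inductive word_equiv :: "'a set \<Rightarrow> ('a gword \<times> 'a gword) set \<Rightarrow> 'a gword \<Rightarrow> 'a gword \<Rightarrow> bool"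
  for X :: "'a set" and R :: "('a gword \<times> 'a gword) set" where
  refl: "u \<in> gwords X \<Longrightarrow> word_equiv X R u u"
| sym: "word_equiv X R u v \<Longrightarrow> word_equiv X R v u"
| trans: "word_equiv X R u v \<Longrightarrow> word_equiv X R v w \<Longrightarrow> word_equiv X R u w"
| append: "word_equiv X R u u' \<Longrightarrow> word_equiv X R v v' \<Longrightarrow> word_equiv X R (u @ v) (u' @ v')"
| cancel: "x \<in> X \<Longrightarrow> word_equiv X R [(x, b), (x, \<not> b)] []"
| rel: "(u, v) \<in> R \<Longrightarrow> u \<in> gwords X \<Longrightarrow> v \<in> gwords X \<Longrightarrow> word_equiv X R u v"

definition word_class :: "'a set \<Rightarrow> ('a gword \<times> 'a gword) set \<Rightarrow> 'a gword \<Rightarrow> 'a gword set" where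
  "word_class X R u = {v. word_equiv X R u v}"

definition presented_group :: "'a set \<Rightarrow> ('a gword \<times> 'a gword) set \<Rightarrow> 'a gword set monoid" where
  "presented_group X R =
    \<lparr> carrier = word_class X R ` gwords X,
      mult = (\<lambda>A B. {w. \<exists>a\<in>A. \<exists>b\<in>B. word_equiv X R (a @ b) w}),
      one = word_class X R [] \<rparr>"

fun word_eval :: "('g, 'm) monoid_scheme \<Rightarrow> ('a \<Rightarrow> 'g) \<Rightarrow> 'a gword \<Rightarrow> 'g" where
  "word_eval G f [] = \<one>\<^bsub>G\<^esub>"
| "word_eval G f ((x, b) # w) = (if b then f x else inv\<^bsub>G\<^esub> (f x)) \<otimes>\<^bsub>G\<^esub> word_eval G f w"

text \<open>The map induced on a presented group by an assignment of the generators; the value is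
  meaningful if the assignment respects the relations.\<close>

definition presented_lift :: "('g, 'm) monoid_scheme \<Rightarrow> ('a \<Rightarrow> 'g) \<Rightarrow> 'a gword set \<Rightarrow> 'g" where
  "presented_lift G f A = the_elem (word_eval G f ` A)"

text \<open>\<open>G\<close> has the presentation with generators \<open>f x\<close>, where \<open>x\<close> ranges over \<open>X\<close>, and relations
  \<open>R\<close>. The condition on \<open>R\<close> ensures that the rule for relations in \<open>word_equiv\<close> ignores none
  of them.\<close>

definition has_presentation ::
  "('g, 'm) monoid_scheme \<Rightarrow> 'a set \<Rightarrow> ('a \<Rightarrow> 'g) \<Rightarrow> ('a gword \<times> 'a gword) set \<Rightarrow> bool" where
  "has_presentation G X f R \<longleftrightarrow>
    group G \<and> R \<subseteq> gwords X \<times> gwords X \<and>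
    (\<exists>\<phi> \<in> iso (presented_group X R) G. \<forall>x\<in>X. \<phi> (word_class X R [(x, True)]) = f x)"

lemma gwords_append [simp]: "u @ v \<in> gwords X \<longleftrightarrow> u \<in> gwords X \<and> v \<in> gwords X"
  by (auto simp: gwords_def)

lemma gwords_Nil [simp]: "[] \<in> gwords X"
  by (simp add: gwords_def)

lemma gwords_Cons [simp]: "(x, b) # u \<in> gwords X \<longleftrightarrow> x \<in> X \<and> u \<in> gwords X"
  by (auto simp: gwords_def)

lemma word_equiv_gwords: "word_equiv X R u v \<Longrightarrow> u \<in> gwords X \<and> v \<in> gwords X"
  by (induction rule: word_equiv.induct) auto

lemma word_class_eq_iff:
  assumes "u \<in> gwords X"
  shows "word_class X R u = word_class X R v \<longleftrightarrow> word_equiv X R u v"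
  using assms by (auto simp: word_class_def intro: word_equiv.intros)

lemma presented_mult:
  assumes "u \<in> gwords X" "v \<in> gwords X"
  shows "word_class X R u \<otimes>\<^bsub>presented_group X R\<^esub> word_class X R v = word_class X R (u @ v)"
  using assms by (auto simp: presented_group_def word_class_def intro: word_equiv.intros)

lemma word_inverse:
  assumes "u \<in> gwords X"
  shows "\<exists>v \<in> gwords X. word_equiv X R (v @ u) []"
  using assms
proof (induction u)
  case Nil
  then show ?case by (intro bexI[of _ "[]"]) (auto intro: word_equiv.refl)
next
  case (Cons l u)
  obtain x b where l: "l = (x, b)" by force
  with Cons obtain v where v: "v \<in> gwords X" "word_equiv X R (v @ u) []" and x: "x \<in> X"
    and u: "u \<in> gwords X"
    by auto
  have "word_equiv X R ([(x, \<not> b), (x, \<not> \<not> b)] @ u) ([] @ u)"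
    using x u by (intro word_equiv.append word_equiv.cancel word_equiv.refl)
  then have "word_equiv X R (v @ ([(x, \<not> b), (x, b)] @ u)) (v @ u)"
    using v(1) by (intro word_equiv.append word_equiv.refl) simp_all
  then have "word_equiv X R ((v @ [(x, \<not> b)]) @ l # u) []"
    using v(2) by (auto simp: l intro: word_equiv.trans)
  then show ?case
    using v(1) x by (intro bexI[of _ "v @ [(x, \<not> b)]"]) auto
qed

lemma presented_group_is_group: "group (presented_group X R)"
proof (rule groupI)
  have carr: "carrier (presented_group X R) = word_class X R ` gwords X"
    and one: "\<one>\<^bsub>presented_group X R\<^esub> = word_class X R []"
    by (simp_all add: presented_group_def)
  show "\<one>\<^bsub>presented_group X R\<^esub> \<in> carrier (presented_group X R)"
    by (simp add: carr one)
  fix A assume "A \<in> carrier (presented_group X R)"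
  then obtain a where a: "a \<in> gwords X" "A = word_class X R a" by (auto simp: carr)
  show "\<one>\<^bsub>presented_group X R\<^esub> \<otimes>\<^bsub>presented_group X R\<^esub> A = A"
    by (simp add: a one presented_mult)
  obtain a' where a': "a' \<in> gwords X" "word_equiv X R (a' @ a) []"
    using word_inverse[OF a(1)] by blast
  then have "word_class X R a' \<otimes>\<^bsub>presented_group X R\<^esub> A = \<one>\<^bsub>presented_group X R\<^esub>"
    by (simp add: a one presented_mult word_class_eq_iff)
  then show "\<exists>A'\<in>carrier (presented_group X R).
      A' \<otimes>\<^bsub>presented_group X R\<^esub> A = \<one>\<^bsub>presented_group X R\<^esub>"
    using a' by (auto simp: carr)
  fix B assume "B \<in> carrier (presented_group X R)"
  then obtain b where b: "b \<in> gwords X" "B = word_class X R b" by (auto simp: carr)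
  show "A \<otimes>\<^bsub>presented_group X R\<^esub> B \<in> carrier (presented_group X R)"
    using a b by (simp add: carr presented_mult)
  fix C assume "C \<in> carrier (presented_group X R)"
  then obtain c where c: "c \<in> gwords X" "C = word_class X R c" by (auto simp: carr)
  show "A \<otimes>\<^bsub>presented_group X R\<^esub> B \<otimes>\<^bsub>presented_group X R\<^esub> C =
      A \<otimes>\<^bsub>presented_group X R\<^esub> (B \<otimes>\<^bsub>presented_group X R\<^esub> C)"
    using a b c by (simp add: presented_mult)
qed

context group
begin

lemma word_eval_closed [simp]:
  "f \<in> X \<rightarrow> carrier G \<Longrightarrow> u \<in> gwords X \<Longrightarrow> word_eval G f u \<in> carrier G"
  by (induction u) (auto simp: Pi_iff)

lemma word_eval_append:
  assumes "f \<in> X \<rightarrow> carrier G" "u \<in> gwords X" "v \<in> gwords X"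
  shows "word_eval G f (u @ v) = word_eval G f u \<otimes> word_eval G f v"
  using assms(2)
proof (induction u)
  case (Cons l u)
  then show ?case using assms by (cases l) (auto simp: m_assoc Pi_iff)
qed (use assms in auto)

lemma word_eval_equiv:
  assumes f: "f \<in> X \<rightarrow> carrier G"
    and R: "\<And>u v. (u, v) \<in> R \<Longrightarrow> word_eval G f u = word_eval G f v"
    and "word_equiv X R u v"
  shows "word_eval G f u = word_eval G f v"
  using assms(3)
proof induction
  case (append u u' v v')
  then show ?case using f by (metis word_equiv_gwords word_eval_append)
next
  case (cancel x b)
  then show ?case using f by (auto simp: Pi_iff)
qed (auto simp: R)

lemma presented_lift_word_class:
  assumes "f \<in> X \<rightarrow> carrier G"
    and "\<And>u v. (u, v) \<in> R \<Longrightarrow> word_eval G f u = word_eval G f v"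
    and "u \<in> gwords X"
  shows "presented_lift G f (word_class X R u) = word_eval G f u"
proof -
  have "word_eval G f ` word_class X R u = {word_eval G f u}"
    using assms(3) word_eval_equiv[OF assms(1,2)]
    by (auto simp: word_class_def intro: word_equiv.refl)
  then show ?thesis by (simp add: presented_lift_def)
qed

lemma presented_lift_hom:
  assumes "f \<in> X \<rightarrow> carrier G"
    and "\<And>u v. (u, v) \<in> R \<Longrightarrow> word_eval G f u = word_eval G f v"
  shows "presented_lift G f \<in> hom (presented_group X R) G"
proof -
  have "carrier (presented_group X R) = word_class X R ` gwords X"
    by (simp add: presented_group_def)
  then show ?thesis
    using assms by (auto simp: hom_def presented_mult presented_lift_word_class word_eval_append)
qed

end


section \<open>The virtual braid group\<close>

datatype vb_gen = Sig nat | Vir nat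

abbreviation sg :: "nat \<Rightarrow> vb_gen \<times> bool" where "sg i \<equiv> (Sig i, True)"
abbreviation vr :: "nat \<Rightarrow> vb_gen \<times> bool" where "vr i \<equiv> (Vir i, True)"

definition VB_gens :: "nat \<Rightarrow> vb_gen set" where
  "VB_gens n = Sig ` {1..<n} \<union> Vir ` {1..<n}"

inductive_set VB_rels :: "nat \<Rightarrow> (vb_gen gword \<times> vb_gen gword) set" for n :: nat where
  B1: "i \<in> {1..<n} \<Longrightarrow> i + 1 \<in> {1..<n} \<Longrightarrow>
    ([sg i, sg (i + 1), sg i], [sg (i + 1), sg i, sg (i + 1)]) \<in> VB_rels n"
| B2: "i \<in> {1..<n} \<Longrightarrow> j \<in> {1..<n} \<Longrightarrow> \<bar>int i - int j\<bar> > 1 \<Longrightarrow>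
    ([sg i, sg j], [sg j, sg i]) \<in> VB_rels n"
| S1: "i \<in> {1..<n} \<Longrightarrow> i + 1 \<in> {1..<n} \<Longrightarrow>
    ([vr i, vr (i + 1), vr i], [vr (i + 1), vr i, vr (i + 1)]) \<in> VB_rels n"
| S2: "i \<in> {1..<n} \<Longrightarrow> j \<in> {1..<n} \<Longrightarrow> \<bar>int i - int j\<bar> > 1 \<Longrightarrow>
    ([vr i, vr j], [vr j, vr i]) \<in> VB_rels n"
| S3: "i \<in> {1..<n} \<Longrightarrow> ([vr i, vr i], []) \<in> VB_rels n"
| M1: "i \<in> {1..<n} \<Longrightarrow> i + 1 \<in> {1..<n} \<Longrightarrow>
    ([vr i, sg (i + 1), vr i], [vr (i + 1), sg i, vr (i + 1)]) \<in> VB_rels n"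
| M2: "i \<in> {1..<n} \<Longrightarrow> j \<in> {1..<n} \<Longrightarrow> \<bar>int i - int j\<bar> > 1 \<Longrightarrow>
    ([sg i, vr j], [vr j, sg i]) \<in> VB_rels n"

definition VB :: "nat \<Rightarrow> vb_gen gword set monoid" where
  "VB n = presented_group (VB_gens n) (VB_rels n)"

abbreviation VB_class :: "nat \<Rightarrow> vb_gen gword \<Rightarrow> vb_gen gword set" where
  "VB_class n \<equiv> word_class (VB_gens n) (VB_rels n)"

fun vb_gen_perm :: "vb_gen \<Rightarrow> nat \<Rightarrow> nat" where
  "vb_gen_perm (Sig i) = transpose i (i + 1)"
| "vb_gen_perm (Vir i) = transpose i (i + 1)"

definition VB_perm :: "nat \<Rightarrow> vb_gen gword set \<Rightarrow> nat \<Rightarrow> nat" where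
  "VB_perm n = presented_lift (sym_group n) vb_gen_perm"

definition VP :: "nat \<Rightarrow> vb_gen gword set monoid" where
  "VP n = (VB n)\<lparr>carrier := kernel (VB n) (sym_group n) (VB_perm n)\<rparr>"

lemma VB_group: "group (VB n)"
  by (simp add: VB_def presented_group_is_group)

lemma VB_rels_gwords: "VB_rels n \<subseteq> gwords (VB_gens n) \<times> gwords (VB_gens n)"
  by (auto simp: VB_gens_def elim!: VB_rels.cases)

lemma vb_gen_perm_closed: "vb_gen_perm \<in> VB_gens n \<rightarrow> carrier (sym_group n)"
  by (auto simp: VB_gens_def sym_group_carrier intro!: permutes_swap_id)

lemma vb_gen_perm_rels:
  assumes "(u, v) \<in> VB_rels n"
  shows "word_eval (sym_group n) vb_gen_perm u = word_eval (sym_group n) vb_gen_perm v"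
  using assms
  by cases (auto simp: sym_group_mult sym_group_one fun_eq_iff transpose_def)

lemma VB_perm_hom: "VB_perm n \<in> hom (VB n) (sym_group n)"
  unfolding VB_perm_def VB_def
  using group.presented_lift_hom[OF sym_group_is_group vb_gen_perm_closed vb_gen_perm_rels] .

lemma VB_perm_class:
  "u \<in> gwords (VB_gens n) \<Longrightarrow>
    VB_perm n (VB_class n u) = word_eval (sym_group n) vb_gen_perm u"
  unfolding VB_perm_def
  using group.presented_lift_word_class[OF sym_group_is_group vb_gen_perm_closed vb_gen_perm_rels] .

lemma VB_perm_gen:
  assumes "i \<in> {1..<n}"
  shows "VB_perm n (VB_class n [sg i]) = transpose i (i + 1)"
    and "VB_perm n (VB_class n [vr i]) = transpose i (i + 1)"
proof -
  have "[sg i] \<in> gwords (VB_gens n)" "[vr i] \<in> gwords (VB_gens n)"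
    using assms by (simp_all add: VB_gens_def)
  then show "VB_perm n (VB_class n [sg i]) = transpose i (i + 1)"
    and "VB_perm n (VB_class n [vr i]) = transpose i (i + 1)"
    by (simp_all add: VB_perm_class sym_group_mult sym_group_one)
qed

lemma VP_group: "group (VP n)"
proof -
  interpret group_hom "VB n" "sym_group n" "VB_perm n"
    by (simp add: group_hom_def group_hom_axioms_def VB_group sym_group_is_group VB_perm_hom)
  show ?thesis
    unfolding VP_def by (rule subgroup.subgroup_is_group[OF subgroup_kernel VB_group])
qed


section \<open>Connecting strings and the relations of the pure virtual braid group\<close>

definition mu_up_word :: "nat \<Rightarrow> nat \<Rightarrow> vb_gen gword" where
  "mu_up_word i j = map vr (rev [i + 1..<j]) @ [sg i, vr i] @ map vr [i + 1..<j]"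

definition transp_word :: "nat \<Rightarrow> nat \<Rightarrow> vb_gen gword" where
  "transp_word i j = map vr [i..<j] @ map vr (rev [i..<j - 1])"

definition mu_word :: "nat \<Rightarrow> nat \<Rightarrow> vb_gen gword" where
  "mu_word r s =
    (if r < s then mu_up_word r s
     else transp_word s r @ mu_up_word s r @ transp_word s r)"

definition mu :: "nat \<Rightarrow> nat \<times> nat \<Rightarrow> vb_gen gword set" where
  "mu n = (\<lambda>(r, s). VB_class n (mu_word r s))"

text \<open>In the presentation below the pair \<open>(r, s)\<close> is the formal symbol that is sent to
  \<open>mu n (r, s)\<close>.\<close>

definition VP_gens :: "nat \<Rightarrow> (nat \<times> nat) set" where
  "VP_gens n = {(r, s). r \<in> {1..n} \<and> s \<in> {1..n} \<and> r \<noteq> s}"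

abbreviation ms :: "nat \<Rightarrow> nat \<Rightarrow> (nat \<times> nat) \<times> bool" where "ms r s \<equiv> ((r, s), True)"

inductive_set VP_rels :: "nat \<Rightarrow> ((nat \<times> nat) gword \<times> (nat \<times> nat) gword) set" for n :: nat where
  triple: "i \<in> {1..n} \<Longrightarrow> j \<in> {1..n} \<Longrightarrow> k \<in> {1..n} \<Longrightarrow> distinct [i, j, k] \<Longrightarrow>
    ([ms i j, ms i k, ms j k], [ms j k, ms i k, ms i j]) \<in> VP_rels n"
| commute: "(i, j) \<in> VP_gens n \<Longrightarrow> (k, l) \<in> VP_gens n \<Longrightarrow> {i, j} \<inter> {k, l} = {} \<Longrightarrow>
    ([ms i j, ms k l], [ms k l, ms i j]) \<in> VP_rels n"

end

theory Submission
  imports Defs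
begin

text \<open>Let \<open>P\<close> be the group with the claimed presentation. Permuting indices lets the symmetric group
  act on \<open>P\<close>. Conjugation by \<open>v\<^sub>k\<close> permutes the indices of the strings \<open>\<mu>\<^sub>r\<^sub>s\<close> by \<open>(k k+1)\<close>, so every
  relation between strings follows from its instance with indices \<open>1, 2, 3\<close> or \<open>1, 2, 3, 4\<close>; this gives a
  homomorphism from \<open>P\<close> to the virtual braid group \<open>VB\<close>. It is injective because
  \<open>\<sigma>\<^sub>i \<mapsto> (\<mu>\<^sub>i\<^sub>,\<^sub>i\<^sub>+\<^sub>1, s\<^sub>i)\<close>, \<open>v\<^sub>i \<mapsto> (1, s\<^sub>i)\<close> defines a homomorphism from \<open>VB\<close> to the semidirect product of \<open>P\<close> and
  the symmetric group that restores \<open>P\<close>. It maps onto the pure group because every element of \<open>VB\<close> is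
  a product of strings followed by a word in the \<open>v\<^sub>i\<close>, and by the Coxeter normal form such a word is
  trivial as soon as its permutation is.\<close>

section \<open>Homomorphisms out of presented groups\<close>

lemma presented_carrier: "carrier (presented_group X R) = word_class X R ` gwords X"
  by (simp add: presented_group_def)

lemma presented_one: "\<one>\<^bsub>presented_group X R\<^esub> = word_class X R []"
  by (simp add: presented_group_def)

lemma presented_class_closed [simp]:
  "u \<in> gwords X \<Longrightarrow> word_class X R u \<in> carrier (presented_group X R)"
  by (simp add: presented_carrier)

lemma presented_cancel:
  assumes "x \<in> X"
  shows "word_class X R [(x, b)] \<otimes>\<^bsub>presented_group X R\<^esub> word_class X R [(x, \<not> b)]
    = \<one>\<^bsub>presented_group X R\<^esub>"
  using assms by (simp add: presented_mult presented_one word_class_eq_iff word_equiv.cancel)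

lemma presented_inv:
  assumes "x \<in> X"
  shows "inv\<^bsub>presented_group X R\<^esub> word_class X R [(x, True)] = word_class X R [(x, False)]"
proof -
  interpret group "presented_group X R" by (rule presented_group_is_group)
  show ?thesis
    using assms presented_cancel[of x X R False] by (intro inv_equality) auto
qed

lemma presented_Cons:
  assumes "x \<in> X" "u \<in> gwords X"
  shows "word_class X R ((x, b) # u)
    = (if b then word_class X R [(x, True)]
       else inv\<^bsub>presented_group X R\<^esub> word_class X R [(x, True)])
      \<otimes>\<^bsub>presented_group X R\<^esub> word_class X R u"
  using assms by (auto simp: presented_inv presented_mult)

lemma presented_rel:
  assumes "(u, v) \<in> R" "u \<in> gwords X" "v \<in> gwords X"
  shows "word_class X R u = word_class X R v"
  using assms by (simp add: word_class_eq_iff word_equiv.rel)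

text \<open>Induction on a representing word. Since \<open>presented_Cons\<close> turns a negative
  letter into the inverse of a generator, agreement on the positive letters is enough. The
  comparisons of homomorphisms below rest on this.\<close>

lemma (in group) presented_hom_eqI:
  assumes f: "f \<in> hom (presented_group X R) G" and g: "g \<in> hom (presented_group X R) G"
    and gens: "\<And>x. x \<in> X \<Longrightarrow> f (word_class X R [(x, True)]) = g (word_class X R [(x, True)])"
    and a: "a \<in> carrier (presented_group X R)"
  shows "f a = g a"
proof -
  interpret P: group "presented_group X R" by (rule presented_group_is_group)
  interpret f: group_hom "presented_group X R" G f
    using f by unfold_locales
  interpret g: group_hom "presented_group X R" G g
    using g by unfold_locales
  obtain u where u: "u \<in> gwords X" "a = word_class X R u"
    using a by (auto simp: presented_carrier)
  have "f (word_class X R u) = g (word_class X R u)"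
    using u(1)
  proof (induction u)
    case Nil
    then show ?case using f.hom_one g.hom_one by (simp add: presented_one)
  next
    case (Cons l u)
    obtain x b where l: "l = (x, b)" by force
    with Cons have x: "x \<in> X" and w: "u \<in> gwords X" by auto
    then show ?case
      using Cons by (simp add: l presented_Cons[of x X u] gens)
  qed
  then show ?thesis by (simp add: u)
qed

section \<open>Relabelling of generators\<close>

definition relabel :: "('a \<Rightarrow> 'b) \<Rightarrow> 'a gword \<Rightarrow> 'b gword" where
  "relabel p = map (map_prod p id)"

lemma relabel_simps [simp]:
  "relabel p [] = []"
  "relabel p ((x, b) # u) = (p x, b) # relabel p u"
  "relabel p (u @ v) = relabel p u @ relabel p v"
  by (simp_all add: relabel_def)

lemma relabel_comp: "relabel (p \<circ> q) u = relabel p (relabel q u)"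
  by (auto simp: relabel_def)

lemma relabel_gwords: "p ` X \<subseteq> Y \<Longrightarrow> u \<in> gwords X \<Longrightarrow> relabel p u \<in> gwords Y"
  by (induction u) (auto simp: image_subset_iff)

lemma relabel_equiv:
  assumes "word_equiv X R u v" "p ` X \<subseteq> Y"
    and "\<And>u v. (u, v) \<in> R \<Longrightarrow> (relabel p u, relabel p v) \<in> S"
  shows "word_equiv Y S (relabel p u) (relabel p v)"
  using assms(1)
proof induction
  case (cancel x b)
  then show ?case using assms(2) by (auto intro!: word_equiv.cancel)
next
  case (append u u' v v')
  then show ?case by (simp add: word_equiv.append)
next
  case (rel u v)
  then show ?case
    using assms(2) by (intro word_equiv.rel assms(3)) (auto intro: relabel_gwords)
next
  case (refl u)
  then show ?case using assms(2) by (intro word_equiv.refl relabel_gwords)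
qed (blast intro: word_equiv.sym word_equiv.trans)+

text \<open>Relabelling preserves equivalence, so the image of a class lies inside one class. That
  it fills this class follows by applying the same argument to the inverse relabelling
  \<open>q\<close>.\<close>

lemma relabel_class:
  assumes pX: "p ` X \<subseteq> X" "q ` X \<subseteq> X" and pq: "p \<circ> q = id" "q \<circ> p = id"
    and R: "\<And>u v. (u, v) \<in> R \<Longrightarrow> (relabel p u, relabel p v) \<in> R"
           "\<And>u v. (u, v) \<in> R \<Longrightarrow> (relabel q u, relabel q v) \<in> R"
  shows "relabel p ` word_class X R u = word_class X R (relabel p u)"
proof -
  have id: "relabel p (relabel q w) = w" "relabel q (relabel p w) = w" for w
    unfolding relabel_comp[symmetric] pq by (simp_all add: relabel_def prod.map_id0)
  show ?thesis
  proof (intro equalityI subsetI)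
    fix w assume "w \<in> relabel p ` word_class X R u"
    then show "w \<in> word_class X R (relabel p u)"
      using relabel_equiv[of X R u _ p X R] pX(1) R(1) by (auto simp: word_class_def)
  next
    fix w assume "w \<in> word_class X R (relabel p u)"
    then have "word_equiv X R u (relabel q w)"
      using relabel_equiv[of X R "relabel p u" w q X R] pX(2) R(2) id by (simp add: word_class_def)
    then show "w \<in> relabel p ` word_class X R u"
      using id(1)[of w] by (force simp: word_class_def image_iff)
  qed
qed


section \<open>Semidirect products\<close>

text \<open>The pair \<open>(a, s)\<close> is to be read as the product of \<open>a\<close> and
  \<open>s\<close> in this order. Moving \<open>s\<close> to the right past \<open>b\<close> turns
  \<open>b\<close> into \<open>act s b\<close>.\<close>

definition semidirect ::
  "('a, 'm) monoid_scheme \<Rightarrow> ('b, 'k) monoid_scheme \<Rightarrow> ('b \<Rightarrow> 'a \<Rightarrow> 'a) \<Rightarrow> ('a \<times> 'b) monoid" where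
  "semidirect G H act =
    \<lparr> carrier = carrier G \<times> carrier H,
      mult = (\<lambda>(a, s) (b, t). (a \<otimes>\<^bsub>G\<^esub> act s b, s \<otimes>\<^bsub>H\<^esub> t)),
      one = (\<one>\<^bsub>G\<^esub>, \<one>\<^bsub>H\<^esub>) \<rparr>"

lemma semidirect_simps [simp]:
  "carrier (semidirect G H act) = carrier G \<times> carrier H"
  "(a, s) \<otimes>\<^bsub>semidirect G H act\<^esub> (b, t) = (a \<otimes>\<^bsub>G\<^esub> act s b, s \<otimes>\<^bsub>H\<^esub> t)"
  "\<one>\<^bsub>semidirect G H act\<^esub> = (\<one>\<^bsub>G\<^esub>, \<one>\<^bsub>H\<^esub>)"
  by (simp_all add: semidirect_def)

lemma semidirect_group:
  assumes "group G" "group H"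
    and hom: "\<And>s. s \<in> carrier H \<Longrightarrow> act s \<in> hom G G"
    and one: "\<And>a. a \<in> carrier G \<Longrightarrow> act \<one>\<^bsub>H\<^esub> a = a"
    and mult: "\<And>s t a. s \<in> carrier H \<Longrightarrow> t \<in> carrier H \<Longrightarrow> a \<in> carrier G \<Longrightarrow>
      act (s \<otimes>\<^bsub>H\<^esub> t) a = act s (act t a)"
  shows "group (semidirect G H act)"
proof -
  interpret G: group G by fact
  interpret H: group H by fact
  have closed: "act s a \<in> carrier G" if "s \<in> carrier H" "a \<in> carrier G" for s a
    using hom[OF that(1)] that(2) by (auto simp: hom_def)
  have act_mult: "act s (a \<otimes>\<^bsub>G\<^esub> b) = act s a \<otimes>\<^bsub>G\<^esub> act s b"
    if "s \<in> carrier H" "a \<in> carrier G" "b \<in> carrier G" for s a b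
    using hom[OF that(1)] that by (auto simp: hom_def)
  show ?thesis
  proof (rule groupI)
    fix x assume "x \<in> carrier (semidirect G H act)"
    then obtain a s where x: "x = (a, s)" "a \<in> carrier G" "s \<in> carrier H" by auto
    \<comment> \<open>\<open>groupI\<close> asks only for a left inverse, namely the inverse of
      \<open>s\<close> followed by the inverse of \<open>a\<close>, rewritten with the first factor
      in front.\<close>
    let ?y = "(act (inv\<^bsub>H\<^esub> s) (inv\<^bsub>G\<^esub> a), inv\<^bsub>H\<^esub> s)"
    have "act (inv\<^bsub>H\<^esub> s) (inv\<^bsub>G\<^esub> a) \<otimes>\<^bsub>G\<^esub> act (inv\<^bsub>H\<^esub> s) a = act (inv\<^bsub>H\<^esub> s) \<one>\<^bsub>G\<^esub>"
      using x by (simp flip: act_mult)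
    also have "\<dots> = \<one>\<^bsub>G\<^esub>"
      using hom[of "inv\<^bsub>H\<^esub> s"] x assms by (auto intro: hom_one)
    finally have "?y \<otimes>\<^bsub>semidirect G H act\<^esub> x = \<one>\<^bsub>semidirect G H act\<^esub>"
      using x by simp
    then show "\<exists>y\<in>carrier (semidirect G H act).
        y \<otimes>\<^bsub>semidirect G H act\<^esub> x = \<one>\<^bsub>semidirect G H act\<^esub>"
      using x closed by (intro bexI[of _ ?y]) auto
  qed (auto simp: closed act_mult mult one G.m_assoc H.m_assoc)
qed


section \<open>Lists of distinct indices\<close>

text \<open>Every transposition is a product of adjacent ones: induction on \<open>b\<close>, with
  \<open>(a b+1) = (b b+1)(a b)(b b+1)\<close>.\<close>

lemma transpose_invariant:
  fixes Q :: "nat list \<Rightarrow> bool"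
  assumes step: "\<And>k xs. 1 \<le> k \<Longrightarrow> k < n \<Longrightarrow> set xs \<subseteq> {1..n} \<Longrightarrow> distinct xs \<Longrightarrow> length xs = l \<Longrightarrow>
      Q xs \<Longrightarrow> Q (map (transpose k (k + 1)) xs)"
    and "1 \<le> a" "a < b" "b \<le> n" "set xs \<subseteq> {1..n}" "distinct xs" "length xs = l" "Q xs"
  shows "Q (map (transpose a b) xs)"
proof -
  have "\<forall>xs. set xs \<subseteq> {1..n} \<longrightarrow> distinct xs \<longrightarrow> length xs = l \<longrightarrow> Q xs \<longrightarrow> Q (map (transpose a b) xs)"
    using \<open>a < b\<close> \<open>b \<le> n\<close>
  proof (induction b)
    case (Suc b)
    show ?case
    proof (cases "a = b")
      case True
      then show ?thesis using step \<open>1 \<le> a\<close> Suc.prems by simp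
    next
      case False
      then have ab: "a < b" "b < n" "1 \<le> b" using Suc.prems by auto
      show ?thesis
      proof (intro allI impI)
        fix xs assume xs: "set xs \<subseteq> {1..n}" "distinct xs" "length xs = l" "Q xs"
        let ?s = "transpose b (b + 1)" and ?t = "transpose a b"
        have conj: "transpose a (Suc b) = ?s \<circ> ?t \<circ> ?s"
          using ab by (auto simp: transpose_def fun_eq_iff)
        have sub: "set (map (transpose c d) ys) \<subseteq> {1..n}"
          if "set ys \<subseteq> {1..n}" "1 \<le> c" "c \<le> n" "1 \<le> d" "d \<le> n" for c d ys
          using that by (auto simp: transpose_def)
        have dist: "distinct (map (transpose c d) ys)" if "distinct ys" for c d :: nat and ys
          using that by (simp add: distinct_map)
        let ?xs1 = "map ?s xs" and ?xs2 = "map ?t (map ?s xs)"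
        have 1: "Q ?xs1" "set ?xs1 \<subseteq> {1..n}" "distinct ?xs1" "length ?xs1 = l"
          using step[OF ab(3,2) xs] sub[of xs b "b + 1"] dist ab xs by auto
        have 2: "Q ?xs2" "set ?xs2 \<subseteq> {1..n}" "distinct ?xs2" "length ?xs2 = l"
          using Suc.IH[rule_format, OF _ _ 1(2-4,1)] 1(4) ab sub[OF 1(2), of a b]
            dist[OF 1(3), of a b] \<open>1 \<le> a\<close> by (simp_all del: map_map)
        show "Q (map (transpose a (Suc b)) xs)"
          using step[OF ab(3,2) 2(2-4) 2(1)] by (simp add: conj o_assoc)
      qed
    qed
  qed simp
  then show ?thesis using assms by simp
qed

text \<open>The symmetric group is transitive on lists of \<open>l\<close> distinct indices, so an
  invariant property need be checked only on \<open>1, ..., l\<close>. This reduces each identity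
  between strings to a single instance.\<close>

lemma distinct_list_orbit:
  fixes Q :: "nat list \<Rightarrow> bool"
  assumes step: "\<And>k xs. 1 \<le> k \<Longrightarrow> k < n \<Longrightarrow> set xs \<subseteq> {1..n} \<Longrightarrow> distinct xs \<Longrightarrow> length xs = l \<Longrightarrow>
      Q xs \<Longrightarrow> Q (map (transpose k (k + 1)) xs)"
    and base: "Q [1..<l + 1]"
    and "set xs \<subseteq> {1..n}" "distinct xs" "length xs = l"
  shows "Q xs"
proof -
  have "l \<le> n"
    using card_mono[of "{1..n}" "set xs"] assms(3-5) by (simp add: distinct_card)
  \<comment> \<open>Downward induction on the length \<open>j\<close> of an initial segment that
    already equals \<open>1, ..., j\<close>. One transposition lengthens the segment by one.\<close>
  have "\<forall>xs. set xs \<subseteq> {1..n} \<longrightarrow> distinct xs \<longrightarrow> length xs = l \<longrightarrow> (\<forall>i<j. xs ! i = i + 1) \<longrightarrow> Q xs"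
    if "j \<le> l" for j
    using that
  proof (induction rule: inc_induct)
    case base
    show ?case
    proof (intro allI impI)
      fix xs :: "nat list" assume "length xs = l" "\<forall>i<l. xs ! i = i + 1"
      then have "xs = [1..<l + 1]" by (intro nth_equalityI) (auto simp del: upt_Suc)
      then show "Q xs" using assms(2) by simp
    qed
  next
    case (step j)
    show ?case
    proof (intro allI impI)
      fix xs :: "nat list"
      assume xs: "set xs \<subseteq> {1..n}" "distinct xs" "length xs = l" "\<forall>i<j. xs ! i = i + 1"
      let ?t = "transpose (j + 1) (xs ! j)"
      have a: "xs ! j \<in> {1..n}" "j + 1 \<le> n"
        using xs step.hyps \<open>l \<le> n\<close> by (auto simp del: atLeastAtMost_iff)
      \<comment> \<open>A value at most \<open>j\<close> already stands in the initial segment, so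
        by distinctness it cannot recur at position \<open>j\<close>. Hence \<open>?t\<close> leaves
        the segment alone.\<close>
      have a_ge: "xs ! j \<ge> j + 1"
      proof (rule ccontr)
        assume "\<not> xs ! j \<ge> j + 1"
        then have "xs ! (xs ! j - 1) = xs ! j" "xs ! j - 1 < j"
          using xs(4) a by auto
        then show False
          using xs step.hyps nth_eq_iff_index_eq[of xs "xs ! j - 1" j] by simp
      qed
      have "Q (map ?t xs)"
      proof (rule step.IH[rule_format])
        show "set (map ?t xs) \<subseteq> {1..n}" using xs a by (auto simp: transpose_def)
        show "distinct (map ?t xs)" using xs by (simp add: distinct_map)
        fix i assume "i < Suc j"
        then show "map ?t xs ! i = i + 1"
          using xs step.hyps a_ge by (cases "i = j") (auto simp: transpose_def)
      qed (use xs in simp)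
      show "Q xs"
      proof (cases "xs ! j = j + 1")
        case True
        then show ?thesis using \<open>Q (map ?t xs)\<close> by simp
      next
        case False
        \<comment> \<open>\<open>Q\<close> is known for the improved list. Since \<open>?t\<close>
          is an involution, applying it once more carries \<open>Q\<close> back to
          \<open>xs\<close>.\<close>
        have "Q (map ?t (map ?t xs))"
          by (rule transpose_invariant[of n l Q, OF assms(1)])
            (use xs a a_ge False \<open>Q (map ?t xs)\<close> in \<open>auto simp: transpose_def distinct_map\<close>)
        then show ?thesis by (simp add: o_def)
      qed
    qed
  qed
  from this[of 0] show ?thesis using assms by simp
qed


section \<open>Conjugation by the virtual generators\<close>

text \<open>An arbitrary group containing elements that satisfy the relations of the virtual braid
  group. It is instantiated both with \<open>VB n\<close> and with the semidirect product, so the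
  computations with strings are done only once. Products are nested to the right, which is the
  normal form of \<open>m_assoc\<close>.\<close>

locale virtual_braid = group G for G (structure) +
  fixes n :: nat and s v :: "nat \<Rightarrow> 'a"
  assumes s_closed [simp]: "1 \<le> i \<Longrightarrow> i < n \<Longrightarrow> s i \<in> carrier G"
    and v_closed [simp]: "1 \<le> i \<Longrightarrow> i < n \<Longrightarrow> v i \<in> carrier G"
    and B1: "1 \<le> i \<Longrightarrow> i + 1 < n \<Longrightarrow> s i \<otimes> (s (i + 1) \<otimes> s i) = s (i + 1) \<otimes> (s i \<otimes> s (i + 1))"
    and B2: "1 \<le> i \<Longrightarrow> i < n \<Longrightarrow> 1 \<le> j \<Longrightarrow> j < n \<Longrightarrow> i + 1 < j \<or> j + 1 < i \<Longrightarrow>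
      s i \<otimes> s j = s j \<otimes> s i"
    and S1: "1 \<le> i \<Longrightarrow> i + 1 < n \<Longrightarrow> v i \<otimes> (v (i + 1) \<otimes> v i) = v (i + 1) \<otimes> (v i \<otimes> v (i + 1))"
    and S2: "1 \<le> i \<Longrightarrow> i < n \<Longrightarrow> 1 \<le> j \<Longrightarrow> j < n \<Longrightarrow> i + 1 < j \<or> j + 1 < i \<Longrightarrow>
      v i \<otimes> v j = v j \<otimes> v i"
    and S3: "1 \<le> i \<Longrightarrow> i < n \<Longrightarrow> v i \<otimes> v i = \<one>"
    and M1: "1 \<le> i \<Longrightarrow> i + 1 < n \<Longrightarrow> v i \<otimes> (s (i + 1) \<otimes> v i) = v (i + 1) \<otimes> (s i \<otimes> v (i + 1))"
    and M2: "1 \<le> i \<Longrightarrow> i < n \<Longrightarrow> 1 \<le> j \<Longrightarrow> j < n \<Longrightarrow> i + 1 < j \<or> j + 1 < i \<Longrightarrow>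
      s i \<otimes> v j = v j \<otimes> s i"
begin

text \<open>By \<open>S3\<close> the element \<open>v k\<close> is its own inverse, so this is
  conjugation.\<close>

definition cj :: "nat \<Rightarrow> 'a \<Rightarrow> 'a" where
  "cj k x = v k \<otimes> (x \<otimes> v k)"

lemma cj_closed [simp]: "1 \<le> k \<Longrightarrow> k < n \<Longrightarrow> x \<in> carrier G \<Longrightarrow> cj k x \<in> carrier G"
  by (simp add: cj_def)

lemma v_cancel: "1 \<le> k \<Longrightarrow> k < n \<Longrightarrow> x \<in> carrier G \<Longrightarrow> v k \<otimes> (v k \<otimes> x) = x"
  by (simp add: S3 flip: m_assoc)

lemma cj_cj [simp]: "1 \<le> k \<Longrightarrow> k < n \<Longrightarrow> x \<in> carrier G \<Longrightarrow> cj k (cj k x) = x"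
  by (simp add: cj_def v_cancel S3 m_assoc)

lemma cj_mult:
  "1 \<le> k \<Longrightarrow> k < n \<Longrightarrow> x \<in> carrier G \<Longrightarrow> y \<in> carrier G \<Longrightarrow> cj k (x \<otimes> y) = cj k x \<otimes> cj k y"
  by (simp add: cj_def v_cancel m_assoc)

lemma cj_commute:
  assumes "1 \<le> i" "i < n" "1 \<le> j" "j < n" "i + 1 < j \<or> j + 1 < i" "x \<in> carrier G"
  shows "cj i (cj j x) = cj j (cj i x)"
proof -
  have "cj i (cj j x) = (v i \<otimes> v j) \<otimes> (x \<otimes> (v j \<otimes> v i))"
    using assms by (simp add: cj_def m_assoc)
  also have "v i \<otimes> v j = v j \<otimes> v i" by (rule S2) (use assms in auto)
  also have "(v j \<otimes> v i) \<otimes> (x \<otimes> (v j \<otimes> v i)) = (v j \<otimes> v i) \<otimes> (x \<otimes> (v i \<otimes> v j))"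
    using S2[of i j] assms by simp
  also have "\<dots> = cj j (cj i x)"
    using assms by (simp add: cj_def m_assoc)
  finally show ?thesis .
qed

lemma cj_braid:
  assumes "1 \<le> i" "i + 1 < n" "x \<in> carrier G"
  shows "cj i (cj (i + 1) (cj i x)) = cj (i + 1) (cj i (cj (i + 1) x))"
proof -
  have "cj i (cj (i + 1) (cj i x)) = (v i \<otimes> (v (i + 1) \<otimes> v i)) \<otimes> (x \<otimes> (v i \<otimes> (v (i + 1) \<otimes> v i)))"
    using assms by (simp add: cj_def m_assoc)
  also have "\<dots> = cj (i + 1) (cj i (cj (i + 1) x))"
    unfolding S1[OF assms(1,2)] using assms by (simp add: cj_def m_assoc)
  finally show ?thesis .
qed

lemma cj_v_commute:
  assumes "1 \<le> i" "i < n" "1 \<le> j" "j < n" "i + 1 < j \<or> j + 1 < i"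
  shows "cj i (v j) = v j"
  using assms S2[of j i] by (auto simp: cj_def v_cancel)

lemma cj_s_commute:
  assumes "1 \<le> i" "i < n" "1 \<le> j" "j < n" "i + 1 < j \<or> j + 1 < i"
  shows "cj i (s j) = s j"
  using assms M2[of j i] by (auto simp: cj_def v_cancel)

lemma cj_cj_v:
  assumes "1 \<le> i" "i + 1 < n"
  shows "cj i (cj (i + 1) (v i)) = v (i + 1)"
proof -
  have "cj (i + 1) (v i) = cj i (v (i + 1))"
    using S1[OF assms] by (simp add: cj_def)
  then show ?thesis using assms by simp
qed

text \<open>\<open>M1\<close> equates the conjugate of \<open>s i\<close> by
  \<open>v (i + 1)\<close> with that of \<open>s (i + 1)\<close> by \<open>v i\<close>, and
  \<open>cj i\<close> is an involution.\<close>

lemma cj_cj_s: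
  assumes "1 \<le> i" "i + 1 < n"
  shows "cj i (cj (i + 1) (s i)) = s (i + 1)"
proof -
  have "cj (i + 1) (s i) = cj i (s (i + 1))"
    using M1[OF assms] by (simp add: cj_def)
  then show ?thesis using assms by simp
qed

section \<open>Strings between distant indices and their conjugates\<close>

text \<open>The string from \<open>i\<close> to \<open>j > i\<close> obtained from a family \<open>m\<close> of strings from \<open>i\<close> to \<open>i + 1\<close>;
  it is used with \<open>m i = s i \<otimes> v i\<close> and with \<open>m i = v i \<otimes> s i\<close>.\<close>

fun string :: "(nat \<Rightarrow> 'a) \<Rightarrow> nat \<Rightarrow> nat \<Rightarrow> 'a" where
  "string m i 0 = m i"
| "string m i (Suc j) = (if j \<le> i then m i else cj j (string m i j))"

end

text \<open>What the action on long strings requires of the short ones. Both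
  \<open>s i \<otimes> v i\<close> and \<open>v i \<otimes> s i\<close> qualify, so upward and
  downward strings are treated together.\<close>

locale virtual_strand = virtual_braid +
  fixes m :: "nat \<Rightarrow> 'a"
  assumes m_closed [simp]: "1 \<le> i \<Longrightarrow> i < n \<Longrightarrow> m i \<in> carrier G"
    and m_far: "1 \<le> i \<Longrightarrow> i < n \<Longrightarrow> 1 \<le> k \<Longrightarrow> k < n \<Longrightarrow> i + 1 < k \<or> k + 1 < i \<Longrightarrow> cj k (m i) = m i"
    and m_shift: "1 \<le> i \<Longrightarrow> i + 1 < n \<Longrightarrow> cj i (cj (i + 1) (m i)) = m (i + 1)"
begin

lemma string_closed [simp]: "1 \<le> i \<Longrightarrow> i < j \<Longrightarrow> j \<le> n \<Longrightarrow> string m i j \<in> carrier G"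
  by (induction j) auto

lemma cj_string_outside:
  assumes "1 \<le> i" "i < j" "j \<le> n" "1 \<le> k" "k < n" "j < k \<or> k + 1 < i"
  shows "cj k (string m i j) = string m i j"
  using assms
proof (induction j)
  case (Suc j)
  show ?case
  proof (cases "j = i")
    case True
    then show ?thesis using Suc.prems m_far[of i k] by auto
  next
    case False
    then have "cj k (cj j (string m i j)) = cj j (cj k (string m i j))"
      using Suc.prems by (intro cj_commute) auto
    then show ?thesis using False Suc by auto
  qed
qed simp

lemma cj_string_top:
  assumes "1 \<le> i" "i < j" "j < n"
  shows "cj j (string m i j) = string m i (j + 1)" "cj j (string m i (j + 1)) = string m i j"
  using assms by auto

text \<open>The string ending at \<open>k + 2\<close> arises from the one ending at \<open>k\<close>
  by \<open>cj k\<close> and then \<open>cj (k + 1)\<close>. By \<open>cj_braid\<close> a further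
  \<open>cj k\<close> turns into a \<open>cj (k + 1)\<close> applied innermost, where it fixes the
  string ending at \<open>k\<close>. The remaining conjugations commute with
  \<open>cj k\<close>.\<close>

lemma cj_string_inside:
  assumes "1 \<le> i" "i < k" "k + 1 < j" "j \<le> n"
  shows "cj k (string m i j) = string m i j"
  using assms
proof (induction j)
  case (Suc j)
  show ?case
  proof (cases "j = k + 1")
    case True
    have "string m i (Suc j) = cj (k + 1) (cj k (string m i k))"
      using True Suc.prems by simp
    moreover have "cj k (cj (k + 1) (cj k (string m i k))) = cj (k + 1) (cj k (cj (k + 1) (string m i k)))"
      using True Suc.prems by (intro cj_braid) auto
    moreover have "cj (k + 1) (string m i k) = string m i k"
      using True Suc.prems by (intro cj_string_outside) auto
    ultimately show ?thesis by simp
  next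
    case False
    then have "cj k (cj j (string m i j)) = cj j (cj k (string m i j))"
      using Suc.prems by (intro cj_commute) auto
    then show ?thesis using False Suc by auto
  qed
qed simp

lemma cj_string_bottom:
  assumes "1 \<le> i" "i + 1 < j" "j \<le> n"
  shows "cj i (string m i j) = string m (i + 1) j"
  using assms
proof (induction j)
  case (Suc j)
  show ?case
  proof (cases "j = i + 1")
    case True
    then show ?thesis using Suc.prems m_shift[of i] by simp
  next
    case False
    then have "cj i (cj j (string m i j)) = cj j (cj i (string m i j))"
      using Suc.prems by (intro cj_commute) auto
    then show ?thesis using False Suc by auto
  qed
qed simp

text \<open>The excluded case is the one in which the transposition reverses the two ends. There
  \<open>cj i\<close> exchanges \<open>s i \<otimes> v i\<close> and
  \<open>v i \<otimes> s i\<close>, which belong to different families.\<close>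

lemma cj_string:
  assumes "1 \<le> i" "i < j" "j \<le> n" "1 \<le> k" "k < n" "\<not> (k = i \<and> j = i + 1)"
  shows "cj k (string m i j) = string m (transpose k (k + 1) i) (transpose k (k + 1) j)"
proof -
  consider "j < k \<or> k + 1 < i" | "k = j" | "j = k + 1" "i < k" | "i < k" "k + 1 < j"
    | "k = i" "i + 1 < j" | "i = k + 1"
    using assms by linarith
  then show ?thesis
  proof cases
    case 1
    then show ?thesis using assms cj_string_outside[of i j k] by (auto simp: transpose_def)
  next
    case 2
    then show ?thesis using assms cj_string_top[of i j] by (auto simp: transpose_def)
  next
    case 3
    then show ?thesis using assms cj_string_top(2)[of i k] by (auto simp: transpose_def)
  next
    case 4
    then show ?thesis using assms cj_string_inside[of i k j] by (auto simp: transpose_def)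
  next
    case 5
    then show ?thesis using assms cj_string_bottom[of i j] by (auto simp: transpose_def)
  next
    case 6
    \<comment> \<open>The bottom case moves the lower end from \<open>k\<close> to
      \<open>k + 1\<close>; since \<open>cj k\<close> is an involution, it also moves it
      back.\<close>
    then have "cj k (string m i j) = cj k (cj k (string m k j))"
      using assms cj_string_bottom[of k j] by auto
    then show ?thesis using assms 6 by (auto simp: transpose_def)
  qed
qed

end

section \<open>The connecting strings as group elements and their relations\<close>

context virtual_braid
begin

lemma strand_sv: "virtual_strand G n s v (\<lambda>i. s i \<otimes> v i)"
proof unfold_locales
  fix i k assume i: "1 \<le> i" "i < n" and k: "1 \<le> k" "k < n" "i + 1 < k \<or> k + 1 < i"
  then have "cj k (s i) = s i" "cj k (v i) = v i"
    by (auto intro!: cj_s_commute cj_v_commute)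
  then show "cj k (s i \<otimes> v i) = s i \<otimes> v i"
    using i k by (simp add: cj_mult)
next
  fix i assume i: "1 \<le> i" "i + 1 < n"
  then have "cj i (cj (i + 1) (s i \<otimes> v i))
      = cj i (cj (i + 1) (s i)) \<otimes> cj i (cj (i + 1) (v i))"
    by (simp add: cj_mult)
  then show "cj i (cj (i + 1) (s i \<otimes> v i)) = s (i + 1) \<otimes> v (i + 1)"
    by (simp only: cj_cj_s[OF i] cj_cj_v[OF i])
qed simp

lemma strand_vs: "virtual_strand G n s v (\<lambda>i. v i \<otimes> s i)"
proof unfold_locales
  fix i k assume i: "1 \<le> i" "i < n" and k: "1 \<le> k" "k < n" "i + 1 < k \<or> k + 1 < i"
  then have "cj k (s i) = s i" "cj k (v i) = v i"
    by (auto intro!: cj_s_commute cj_v_commute)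
  then show "cj k (v i \<otimes> s i) = v i \<otimes> s i"
    using i k by (simp add: cj_mult)
next
  fix i assume i: "1 \<le> i" "i + 1 < n"
  then have "cj i (cj (i + 1) (v i \<otimes> s i))
      = cj i (cj (i + 1) (v i)) \<otimes> cj i (cj (i + 1) (s i))"
    by (simp add: cj_mult)
  then show "cj i (cj (i + 1) (v i \<otimes> s i)) = v (i + 1) \<otimes> s (i + 1)"
    by (simp only: cj_cj_s[OF i] cj_cj_v[OF i])
qed simp

text \<open>A downward string is built directly from the \<open>v i \<otimes> s i\<close>, without
  the words for transpositions. \<open>transp_word_conj\<close> shows that this agrees with
  conjugating the upward string.\<close>

definition mu_el :: "nat \<Rightarrow> nat \<Rightarrow> 'a" where
  "mu_el i j = (if i < j then string (\<lambda>i. s i \<otimes> v i) i j else string (\<lambda>i. v i \<otimes> s i) j i)"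

lemma mu_el_closed [simp]:
  "1 \<le> i \<Longrightarrow> i \<le> n \<Longrightarrow> 1 \<le> j \<Longrightarrow> j \<le> n \<Longrightarrow> i \<noteq> j \<Longrightarrow> mu_el i j \<in> carrier G"
  using virtual_strand.string_closed[OF strand_sv] virtual_strand.string_closed[OF strand_vs]
  by (simp add: mu_el_def)

text \<open>The key equivariance. Away from the pair \<open>k\<close>, \<open>k + 1\<close> the
  transposition preserves the order of the ends and \<open>cj_string\<close> applies within one
  family; on that pair the two families are exchanged.\<close>

lemma cj_mu_el:
  assumes "1 \<le> i" "i \<le> n" "1 \<le> j" "j \<le> n" "i \<noteq> j" "1 \<le> k" "k < n"
  shows "cj k (mu_el i j) = mu_el (transpose k (k + 1) i) (transpose k (k + 1) j)"
proof -
  have sv: "cj k (string (\<lambda>i. s i \<otimes> v i) i j)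
      = string (\<lambda>i. s i \<otimes> v i) (transpose k (k + 1) i) (transpose k (k + 1) j)"
    and vs: "cj k (string (\<lambda>i. v i \<otimes> s i) i j)
      = string (\<lambda>i. v i \<otimes> s i) (transpose k (k + 1) i) (transpose k (k + 1) j)"
    if "1 \<le> i" "i < j" "j \<le> n" "\<not> (k = i \<and> j = i + 1)" for i j
    using that assms virtual_strand.cj_string[OF strand_sv] virtual_strand.cj_string[OF strand_vs]
    by simp_all
  have less: "transpose k (k + 1) i < transpose k (k + 1) j" if "i < j" "\<not> (k = i \<and> j = i + 1)" for i j
    using that by (auto simp: transpose_def)
  consider "i < j" "\<not> (k = i \<and> j = i + 1)" | "k = i" "j = i + 1" | "j < i" "\<not> (k = j \<and> i = j + 1)"
    | "k = j" "i = j + 1" using assms by linarith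
  then show ?thesis
  proof cases
    case 1
    then show ?thesis using \<open>1 \<le> i\<close> \<open>j \<le> n\<close> sv[of i j] less[of i j] by (simp add: mu_el_def)
  next
    case 2
    then show ?thesis using assms by (simp add: mu_el_def cj_def S3 m_assoc)
  next
    case 3
    then show ?thesis using \<open>1 \<le> j\<close> \<open>i \<le> n\<close> vs[of j i] less[of j i] by (simp add: mu_el_def)
  next
    case 4
    then show ?thesis using assms by (simp add: mu_el_def cj_def S3 v_cancel m_assoc)
  qed
qed

text \<open>\<open>M1\<close> yields two expressions for \<open>mu_el 1 3\<close>, one suited to
  each side. Collecting the \<open>v\<close>'s on the right turns the sides into
  \<open>s 1 s 2 s 1 v 2 v 1 v 2\<close> and \<open>s 2 s 1 s 2 v 1 v 2 v 1\<close>, which agree by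
  \<open>B1\<close> and \<open>S1\<close>.\<close>

lemma mu_el_triple_base:
  assumes "3 \<le> n"
  shows "mu_el 1 2 \<otimes> (mu_el 1 3 \<otimes> mu_el 2 3) = mu_el 2 3 \<otimes> (mu_el 1 3 \<otimes> mu_el 1 2)"
proof -
  have 12: "mu_el 1 2 = s 1 \<otimes> v 1" and 23: "mu_el 2 3 = s 2 \<otimes> v 2"
    by (simp_all add: mu_el_def numeral_eq_Suc)
  note c [simp] = s_closed[of 1] s_closed[of 2] v_closed[of 1] v_closed[of 2]
  have "mu_el 1 3 = cj 1 (mu_el 2 3)"
    using cj_mu_el[of 2 3 1] assms by (simp add: transpose_def numeral_eq_Suc)
  then have 13: "mu_el 1 3 = v 1 \<otimes> (s 2 \<otimes> (v 2 \<otimes> v 1))"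
    unfolding 23 using assms by (simp add: cj_def m_assoc)
  have "mu_el 1 3 = cj 2 (mu_el 1 2)"
    using cj_mu_el[of 1 2 2] assms by (simp add: transpose_def numeral_eq_Suc)
  then have alt13: "mu_el 1 3 = v 2 \<otimes> (s 1 \<otimes> (v 1 \<otimes> v 2))"
    unfolding 12 using assms by (simp add: cj_def m_assoc)
  have M: "v 1 \<otimes> (s 2 \<otimes> v 1) = v 2 \<otimes> (s 1 \<otimes> v 2)"
    using M1[of 1] assms by (simp add: numeral_eq_Suc)
  have "v 2 \<otimes> (v 1 \<otimes> s 2) = v 2 \<otimes> ((v 1 \<otimes> (s 2 \<otimes> v 1)) \<otimes> v 1)"
    using assms by (simp add: m_assoc S3)
  also have "\<dots> = s 1 \<otimes> (v 2 \<otimes> v 1)"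
    unfolding M using assms by (simp add: m_assoc v_cancel)
  \<comment> \<open>This form of \<open>M1\<close> moves \<open>s 2\<close> leftwards past
    \<open>v 2 \<otimes> v 1\<close>, where it becomes \<open>s 1\<close>. The identity
    \<open>2\<close> below does the same for \<open>s 1\<close> past
    \<open>v 1 \<otimes> v 2\<close>.\<close>
  finally have 1: "v 2 \<otimes> (v 1 \<otimes> s 2) = s 1 \<otimes> (v 2 \<otimes> v 1)" .
  have "v 1 \<otimes> (v 2 \<otimes> s 1) = v 1 \<otimes> ((v 2 \<otimes> (s 1 \<otimes> v 2)) \<otimes> v 2)"
    using assms by (simp add: m_assoc S3)
  also have "\<dots> = s 2 \<otimes> (v 1 \<otimes> v 2)"
    unfolding M[symmetric] using assms by (simp add: m_assoc v_cancel)
  finally have 2: "v 1 \<otimes> (v 2 \<otimes> s 1) = s 2 \<otimes> (v 1 \<otimes> v 2)" .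
  have "mu_el 1 2 \<otimes> (mu_el 1 3 \<otimes> mu_el 2 3) = s 1 \<otimes> (s 2 \<otimes> ((v 2 \<otimes> (v 1 \<otimes> s 2)) \<otimes> v 2))"
    using assms unfolding 12 23 13 by (simp add: m_assoc v_cancel)
  also have "\<dots> = (s 1 \<otimes> (s 2 \<otimes> s 1)) \<otimes> (v 2 \<otimes> (v 1 \<otimes> v 2))"
    unfolding 1 using assms by (simp add: m_assoc)
  also have "\<dots> = (s 2 \<otimes> (s 1 \<otimes> s 2)) \<otimes> (v 1 \<otimes> (v 2 \<otimes> v 1))"
    using B1[of 1] S1[of 1] assms by (simp add: numeral_eq_Suc)
  also have "\<dots> = s 2 \<otimes> (s 1 \<otimes> ((v 1 \<otimes> (v 2 \<otimes> s 1)) \<otimes> v 1))"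
    unfolding 2 using assms by (simp add: m_assoc)
  also have "\<dots> = mu_el 2 3 \<otimes> (mu_el 1 3 \<otimes> mu_el 1 2)"
    using assms unfolding 12 23 alt13 by (simp add: m_assoc v_cancel)
  finally show ?thesis .
qed

lemma mu_el_triple:
  assumes "distinct [i, j, k]" "{i, j, k} \<subseteq> {1..n}"
  shows "mu_el i j \<otimes> (mu_el i k \<otimes> mu_el j k) = mu_el j k \<otimes> (mu_el i k \<otimes> mu_el i j)"
proof -
  \<comment> \<open>Phrased for lists, the relation fits \<open>distinct_list_orbit\<close>; its
    invariance comes from applying \<open>cj k\<close> to both sides.\<close>
  define Q where "Q = (\<lambda>xs. \<forall>i j k. xs = [i, j, k] \<longrightarrow>
    mu_el i j \<otimes> (mu_el i k \<otimes> mu_el j k) = mu_el j k \<otimes> (mu_el i k \<otimes> mu_el i j))"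
  have "Q [i, j, k]"
  proof (rule distinct_list_orbit[of n 3 Q])
    fix k xs assume *: "1 \<le> k" "k < n" "set xs \<subseteq> {1..n}" "distinct xs" "length xs = 3" "Q xs"
    from *(5) obtain a b c where xs: "xs = [a, b, c]"
      by (auto simp: length_Suc_conv numeral_eq_Suc)
    have "mu_el a b \<otimes> (mu_el a c \<otimes> mu_el b c) = mu_el b c \<otimes> (mu_el a c \<otimes> mu_el a b)"
      using *(6) by (simp add: Q_def xs)
    from arg_cong[OF this, of "cj k"] show "Q (map (transpose k (k + 1)) xs)"
      using *(1-4) by (simp add: Q_def xs cj_mult cj_mu_el)
  next
    have "card {i, j, k} = 3" using assms by simp
    then have "3 \<le> n" using card_mono[OF _ assms(2)] by simp
    then show "Q [1..<3 + 1]"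
      using mu_el_triple_base by (simp add: Q_def numeral_eq_Suc)
  qed (use assms in auto)
  then show ?thesis by (simp add: Q_def)
qed

text \<open>The same reduction leaves the strings \<open>1, 2\<close> and \<open>3, 4\<close>, whose
  letters commute by \<open>B2\<close>, \<open>S2\<close> and \<open>M2\<close>.\<close>

lemma mu_el_commute:
  assumes "distinct [i, j, k, l]" "{i, j, k, l} \<subseteq> {1..n}"
  shows "mu_el i j \<otimes> mu_el k l = mu_el k l \<otimes> mu_el i j"
proof -
  define Q where "Q = (\<lambda>xs. \<forall>i j k l. xs = [i, j, k, l] \<longrightarrow>
    mu_el i j \<otimes> mu_el k l = mu_el k l \<otimes> mu_el i j)"
  have "Q [i, j, k, l]"
  proof (rule distinct_list_orbit[of n 4 Q])
    fix k xs assume *: "1 \<le> k" "k < n" "set xs \<subseteq> {1..n}" "distinct xs" "length xs = 4" "Q xs"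
    from *(5) obtain a b c d where xs: "xs = [a, b, c, d]"
      by (auto simp: length_Suc_conv numeral_eq_Suc)
    have "mu_el a b \<otimes> mu_el c d = mu_el c d \<otimes> mu_el a b"
      using *(6) by (simp add: Q_def xs)
    from arg_cong[OF this, of "cj k"] show "Q (map (transpose k (k + 1)) xs)"
      using *(1-4) by (simp add: Q_def xs cj_mult cj_mu_el)
  next
    have "card {i, j, k, l} = 4" using assms by simp
    then have n: "4 \<le> n" using card_mono[OF _ assms(2)] by simp
    then have c [simp]: "s (Suc 0) \<in> carrier G" "s 3 \<in> carrier G" "v (Suc 0) \<in> carrier G" "v 3 \<in> carrier G"
      by simp_all
    have "(s 1 \<otimes> v 1) \<otimes> (s 3 \<otimes> v 3) = s 1 \<otimes> ((v 1 \<otimes> s 3) \<otimes> v 3)"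
      by (simp add: m_assoc)
    also have "\<dots> = (s 1 \<otimes> s 3) \<otimes> (v 1 \<otimes> v 3)"
      using n M2[of 3 1, symmetric] by (simp add: m_assoc)
    also have "\<dots> = (s 3 \<otimes> s 1) \<otimes> (v 3 \<otimes> v 1)"
      using n B2[of 1 3] S2[of 1 3] by simp
    also have "\<dots> = s 3 \<otimes> ((s 1 \<otimes> v 3) \<otimes> v 1)"
      by (simp add: m_assoc)
    also have "\<dots> = (s 3 \<otimes> v 3) \<otimes> (s 1 \<otimes> v 1)"
      using n M2[of 1 3] by (simp add: m_assoc)
    finally show "Q [1..<4 + 1]"
      by (simp add: Q_def mu_el_def numeral_eq_Suc)
  qed (use assms in auto)
  then show ?thesis by (simp add: Q_def)
qed

section \<open>Evaluation of the words for the connecting strings\<close>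

definition gen :: "vb_gen \<Rightarrow> 'a" where
  "gen x = (case x of Sig i \<Rightarrow> s i | Vir i \<Rightarrow> v i)"

lemma gen_simps [simp]: "gen (Sig i) = s i" "gen (Vir i) = v i"
  by (simp_all add: gen_def)

lemma VB_gens_iff [simp]: "Sig i \<in> VB_gens n \<longleftrightarrow> 1 \<le> i \<and> i < n" "Vir i \<in> VB_gens n \<longleftrightarrow> 1 \<le> i \<and> i < n"
  by (auto simp: VB_gens_def)

lemma gen_closed: "gen \<in> VB_gens n \<rightarrow> carrier G"
  by (auto simp: VB_gens_def)

lemma gen_rels:
  assumes "(x, y) \<in> VB_rels n"
  shows "word_eval G gen x = word_eval G gen y"
  using assms
proof cases
  case (B1 i)
  then show ?thesis using virtual_braid.B1[OF virtual_braid_axioms, of i] by simp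
next
  case (B2 i j)
  then have "s i \<otimes> s j = s j \<otimes> s i" by (intro virtual_braid.B2[OF virtual_braid_axioms]) auto
  then show ?thesis using B2 by simp
next
  case (S1 i)
  then show ?thesis using virtual_braid.S1[OF virtual_braid_axioms, of i] by simp
next
  case (S2 i j)
  then have "v i \<otimes> v j = v j \<otimes> v i" by (intro virtual_braid.S2[OF virtual_braid_axioms]) auto
  then show ?thesis using S2 by simp
next
  case (S3 i)
  then show ?thesis using virtual_braid.S3[OF virtual_braid_axioms, of i] by simp
next
  case (M1 i)
  then show ?thesis using virtual_braid.M1[OF virtual_braid_axioms, of i] by simp
next
  case (M2 i j)
  then have "s i \<otimes> v j = v j \<otimes> s i" by (intro virtual_braid.M2[OF virtual_braid_axioms]) auto
  then show ?thesis using M2 by simp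
qed

lemma word_eval_sandwich:
  assumes "w \<in> gwords (VB_gens n)" "1 \<le> k" "k < n"
  shows "word_eval G gen (vr k # w @ [vr k]) = cj k (word_eval G gen w)"
  using assms gen_closed word_eval_closed[OF gen_closed]
  by (simp add: word_eval_append[OF gen_closed] cj_def)

lemma mu_up_word_Suc: "i < j \<Longrightarrow> mu_up_word i (Suc j) = vr j # mu_up_word i j @ [vr j]"
  by (simp add: mu_up_word_def)

lemma mu_up_word_gwords: "1 \<le> i \<Longrightarrow> i < j \<Longrightarrow> j \<le> n \<Longrightarrow> mu_up_word i j \<in> gwords (VB_gens n)"
  by (auto simp: mu_up_word_def gwords_def)

lemma word_eval_mu_up_word:
  assumes "1 \<le> i" "i < j" "j \<le> n"
  shows "word_eval G gen (mu_up_word i j) = string (\<lambda>i. s i \<otimes> v i) i j"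
  using assms
proof (induction j)
  case (Suc j)
  show ?case
  proof (cases "j = i")
    case True
    then show ?thesis using Suc.prems by (simp add: mu_up_word_def)
  next
    case False
    then show ?thesis
      using Suc word_eval_sandwich[of "mu_up_word i j" j] mu_up_word_gwords[of i j]
      by (simp add: mu_up_word_Suc)
  qed
qed simp

lemma transp_word_gwords: "1 \<le> i \<Longrightarrow> i < j \<Longrightarrow> j \<le> n \<Longrightarrow> transp_word i j \<in> gwords (VB_gens n)"
  by (auto simp: transp_word_def gwords_def less_diff_conv)

lemma transp_word_Suc:
  assumes "Suc i < j"
  shows "transp_word i j = vr i # transp_word (Suc i) j @ [vr i]"
proof -
  have "[i..<j] = i # [Suc i..<j]" "[i..<j - 1] = i # [Suc i..<j - 1]"
    using assms by (auto intro: upt_conv_Cons)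
  then show ?thesis by (simp add: transp_word_def)
qed

text \<open>The word for the transposition is \<open>v i\<close>, then the word from
  \<open>i + 1\<close> to \<open>j\<close>, then \<open>v i\<close>. The inner \<open>cj i\<close>
  moves the lower end up to \<open>i + 1\<close>, the induction hypothesis reverses the string, and
  the outer \<open>cj i\<close> moves that end back.\<close>

lemma transp_word_conj:
  assumes "i < j" "1 \<le> i" "j \<le> n"
  shows "word_eval G gen (transp_word i j) \<otimes> (mu_el i j \<otimes> word_eval G gen (transp_word i j)) = mu_el j i"
proof -
  \<comment> \<open>\<open>d\<close> counts the indices strictly between \<open>i\<close> and
    \<open>j\<close>.\<close>
  obtain d where "j = Suc (i + d)" using assms(1) less_iff_Suc_add by auto
  then show ?thesis using assms
  proof (induction d arbitrary: i)
    case 0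
    then show ?case using cj_mu_el[of i j i] by (simp add: transp_word_def cj_def)
  next
    case (Suc d)
    let ?t = "word_eval G gen (transp_word (Suc i) j)"
    have [simp]: "?t \<in> carrier G"
      using Suc.prems by (intro word_eval_closed[OF gen_closed] transp_word_gwords) auto
    have "word_eval G gen (transp_word i j) = v i \<otimes> (?t \<otimes> v i)"
      using Suc.prems word_eval_sandwich[of "transp_word (Suc i) j" i] transp_word_gwords[of "Suc i" j]
      by (simp add: transp_word_Suc cj_def)
    then have "word_eval G gen (transp_word i j) \<otimes> (mu_el i j \<otimes> word_eval G gen (transp_word i j))
      = cj i (?t \<otimes> (cj i (mu_el i j) \<otimes> ?t))"
      using Suc.prems(2-) by (simp add: cj_def m_assoc)
    also have "cj i (mu_el i j) = mu_el (Suc i) j"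
      using Suc.prems cj_mu_el[of i j i] by (simp add: transpose_def)
    also have "?t \<otimes> (mu_el (Suc i) j \<otimes> ?t) = mu_el j (Suc i)"
      using Suc.prems by (intro Suc.IH) auto
    also have "cj i (mu_el j (Suc i)) = mu_el j i"
      using Suc.prems cj_mu_el[of j "Suc i" i] by (simp add: transpose_def)
    finally show ?case .
  qed
qed

lemma mu_word_gwords: "(i, j) \<in> VP_gens n \<Longrightarrow> mu_word i j \<in> gwords (VB_gens n)"
  by (auto simp: mu_word_def VP_gens_def intro: mu_up_word_gwords transp_word_gwords)

lemma word_eval_mu_word:
  assumes "(i, j) \<in> VP_gens n"
  shows "word_eval G gen (mu_word i j) = mu_el i j"
proof (cases "i < j")
  case True
  then show ?thesis
    using assms by (simp add: mu_word_def mu_el_def VP_gens_def word_eval_mu_up_word)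
next
  case False
  then have "mu_el j i = string (\<lambda>i. s i \<otimes> v i) j i" "j < i" "1 \<le> j" "i \<le> n"
    using assms by (auto simp: mu_el_def VP_gens_def)
  then show ?thesis
    using transp_word_conj[of j i] False
    by (simp add: mu_word_def word_eval_append[OF gen_closed] mu_up_word_gwords transp_word_gwords
        word_eval_mu_up_word)
qed

end


section \<open>The relations among the transpositions\<close>

context virtual_braid
begin

primrec vprod :: "nat list \<Rightarrow> 'a" where
  "vprod [] = \<one>"
| "vprod (k # ks) = v k \<otimes> vprod ks"

lemma vprod_closed [simp]: "set ks \<subseteq> {1..<n} \<Longrightarrow> vprod ks \<in> carrier G"
  by (induction ks) auto

lemma vprod_append:
  "set ks \<subseteq> {1..<n} \<Longrightarrow> set ls \<subseteq> {1..<n} \<Longrightarrow> vprod (ks @ ls) = vprod ks \<otimes> vprod ls"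
  by (induction ks) (auto simp: m_assoc)

lemma vprod_commute:
  assumes "1 \<le> i" "i < n" "set ks \<subseteq> {1..<n}" "\<And>k. k \<in> set ks \<Longrightarrow> i + 1 < k \<or> k + 1 < i"
  shows "vprod ks \<otimes> v i = v i \<otimes> vprod ks"
  using assms(3,4)
proof (induction ks)
  case (Cons k ks)
  then have k: "1 \<le> k" "k < n" "i + 1 < k \<or> k + 1 < i" and ks: "set ks \<subseteq> {1..<n}" by auto
  have "vprod (k # ks) \<otimes> v i = v k \<otimes> (v i \<otimes> vprod ks)"
    using Cons k ks assms by (simp add: m_assoc)
  also have "\<dots> = (v i \<otimes> v k) \<otimes> vprod ks"
    using S2[of i k] k ks assms by (simp add: m_assoc)
  finally show ?case using k ks assms by (simp add: m_assoc)
qed (use assms in simp)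

text \<open>The coset representative \<open>v\<^sub>m v\<^sub>m\<^sub>-\<^sub>1 \<dots> v\<^sub>k\<close>, which is \<open>\<one>\<close> for \<open>k = m + 1\<close>; its permutation sends
  \<open>k\<close> to \<open>m + 1\<close>.\<close>

definition descent :: "nat \<Rightarrow> nat \<Rightarrow> 'a" where
  "descent k m = vprod (rev [k..<Suc m])"

lemma descent_closed [simp]: "1 \<le> k \<Longrightarrow> m < n \<Longrightarrow> descent k m \<in> carrier G"
  by (auto simp: descent_def intro!: vprod_closed)

lemma descent_trivial [simp]: "descent (Suc m) m = \<one>"
  by (simp add: descent_def)

lemma descent_Suc: "k \<le> Suc m \<Longrightarrow> descent k (Suc m) = v (Suc m) \<otimes> descent k m"
  by (simp add: descent_def)

lemma descent_rec:
  assumes "1 \<le> k" "k \<le> m" "m < n"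
  shows "descent k m = descent (Suc k) m \<otimes> v k"
proof -
  have "rev [k..<Suc m] = rev [Suc k..<Suc m] @ [k]"
    using assms by (simp only: upt_conv_Cons) (simp add: upt_conv_Cons)
  moreover have "vprod (rev [Suc k..<Suc m] @ [k]) = vprod (rev [Suc k..<Suc m]) \<otimes> vprod [k]"
    using assms by (intro vprod_append) auto
  ultimately show ?thesis using assms by (simp add: descent_def)
qed

text \<open>In \<open>v m ... v k\<close> followed by \<open>v i\<close>, the last letter commutes
  leftwards until it meets \<open>v i v (i-1)\<close>. The braid relation turns it into
  \<open>v (i-1)\<close>, which commutes with all the remaining letters.\<close>

lemma descent_slide:
  assumes "1 \<le> k" "k < i" "i \<le> m" "m < n"
  shows "descent k m \<otimes> v i = v (i - 1) \<otimes> descent k m"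
  using assms(3,4)
proof (induction m rule: dec_induct)
  case base
  \<comment> \<open>Writing \<open>i = l + 2\<close> exposes the two letters for the braid relation;
    \<open>descent k l\<close> is the possibly empty rest.\<close>
  obtain l where l: "i = Suc (Suc l)" "k \<le> Suc l"
    using assms by (cases i; cases "i - 1") auto
  have D: "descent k i = v (Suc (Suc l)) \<otimes> (v (Suc l) \<otimes> descent k l)"
    using l by (simp add: descent_Suc)
  have c [simp]: "descent k l \<in> carrier G" "v (Suc l) \<in> carrier G" "v (Suc (Suc l)) \<in> carrier G"
    using l assms base by auto
  have "descent k l \<otimes> v i = v i \<otimes> descent k l"
    unfolding descent_def using l assms base by (intro vprod_commute) auto
  then have "descent k i \<otimes> v i = (v (Suc (Suc l)) \<otimes> (v (Suc l) \<otimes> v (Suc (Suc l)))) \<otimes> descent k l"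
    unfolding D by (simp add: m_assoc l)
  also have "\<dots> = (v (Suc l) \<otimes> (v (Suc (Suc l)) \<otimes> v (Suc l))) \<otimes> descent k l"
    using S1[of "Suc l"] l base by simp
  finally show ?case unfolding D by (simp add: l m_assoc)
next
  case (step m)
  have D: "descent k (Suc m) = v (Suc m) \<otimes> descent k m"
    using step assms by (simp add: descent_Suc)
  have c [simp]: "descent k m \<in> carrier G" "v i \<in> carrier G" "v (i - Suc 0) \<in> carrier G"
      "v (Suc m) \<in> carrier G"
    using step assms by auto
  have "descent k (Suc m) \<otimes> v i = (v (Suc m) \<otimes> v (i - 1)) \<otimes> descent k m"
    unfolding D using step by (simp add: m_assoc)
  also have "v (Suc m) \<otimes> v (i - 1) = v (i - 1) \<otimes> v (Suc m)"
    using step assms by (intro S2) auto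
  finally show ?case unfolding D by (simp add: m_assoc)
qed

text \<open>One step of the Coxeter normal form, by appending letters on the right. A new letter
  \<open>v i\<close> commutes past the descent if \<open>i + 1 < k\<close>, lengthens it if
  \<open>k = i + 1\<close>, cancels its last letter if \<open>i = k\<close>, and emerges on the left
  as \<open>v (i - 1)\<close> if \<open>k < i\<close>.\<close>

lemma vprod_normal_form:
  assumes "set ks \<subseteq> {1..m}" "m < n"
  shows "\<exists>ls k. set ls \<subseteq> {1..<m} \<and> 1 \<le> k \<and> k \<le> Suc m \<and> vprod ks = vprod ls \<otimes> descent k m"
  using assms(1)
proof (induction ks rule: rev_induct)
  case Nil
  show ?case by (rule exI[of _ "[]"], rule exI[of _ "Suc m"]) simp
next
  case (snoc i ks)
  then obtain ls k where ls: "set ls \<subseteq> {1..<m}" and k: "1 \<le> k" "k \<le> Suc m"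
    and eq: "vprod ks = vprod ls \<otimes> descent k m" by auto
  have i: "1 \<le> i" "i \<le> m" "i < n" using snoc.prems assms by auto
  have lsn: "set ls \<subseteq> {1..<n}" using ls assms by auto
  have [simp]: "vprod ls \<in> carrier G" "descent k m \<in> carrier G" "v i \<in> carrier G"
    using lsn k i assms by simp_all
  have "set ks \<subseteq> {1..<n}" using snoc.prems assms by auto
  then have eq': "vprod (ks @ [i]) = vprod ls \<otimes> (descent k m \<otimes> v i)"
    using i eq by (simp add: vprod_append m_assoc)
  consider "i + 1 < k" | "k = Suc i" | "i = k" | "k < i" by linarith
  then show ?case
  proof cases
    case 1
    have "descent k m \<otimes> v i = v i \<otimes> descent k m"
      unfolding descent_def using 1 i assms by (intro vprod_commute) auto
    then have "vprod (ks @ [i]) = vprod (ls @ [i]) \<otimes> descent k m"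
      unfolding eq' using lsn i by (simp add: vprod_append m_assoc)
    moreover have "set (ls @ [i]) \<subseteq> {1..<m}" using ls 1 i k by auto
    ultimately show ?thesis using k by blast
  next
    case 2
    then have "vprod (ks @ [i]) = vprod ls \<otimes> descent i m"
      unfolding eq' using i assms by (simp add: descent_rec)
    moreover have "i \<le> Suc m" using i by simp
    ultimately show ?thesis using ls i(1) by blast
  next
    case 3
    then have "vprod (ks @ [i]) = vprod ls \<otimes> descent (Suc k) m"
      unfolding eq' using i k assms by (simp add: descent_rec[of k] m_assoc S3)
    moreover have "1 \<le> Suc k" "Suc k \<le> Suc m" using i 3 by auto
    ultimately show ?thesis using ls by blast
  next
    case 4
    then have j: "Suc 0 \<le> i - Suc 0" "i - Suc 0 < n" using i k by auto
    with 4 have "vprod (ks @ [i]) = vprod (ls @ [i - 1]) \<otimes> descent k m"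
      unfolding eq' using lsn i k assms by (simp add: descent_slide vprod_append m_assoc)
    moreover have "set (ls @ [i - 1]) \<subseteq> {1..<m}" using ls 4 i k by auto
    ultimately show ?thesis using k by blast
  qed
qed

text \<open>Induction on the number of indices. In the normal form the prefix fixes
  \<open>m + 1\<close> while the descent sends \<open>k\<close> to \<open>m + 1\<close>; if the
  whole permutation is trivial, then \<open>k = m + 1\<close>, so the descent is empty and a shorter
  range of letters remains.\<close>

lemma vprod_eq_one:
  assumes h: "h \<in> hom G (sym_group n)"
    and hv: "\<And>i. 1 \<le> i \<Longrightarrow> i < n \<Longrightarrow> h (v i) = transpose i (i + 1)"
    and "set ks \<subseteq> {1..<n}" "h (vprod ks) = id"
  shows "vprod ks = \<one>"
proof -
  interpret h: group_hom G "sym_group n" h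
    using h by (simp add: group_hom_def group_hom_axioms_def sym_group_is_group)
  have h_vprod: "h (vprod ks) x = x" if "set ks \<subseteq> {1..<m}" "m < x" "m \<le> n" for ks m x
    using that
  proof (induction ks)
    case (Cons k ks)
    then have "set ks \<subseteq> {1..<n}" by auto
    then show ?case using Cons by (auto simp: sym_group_mult hv transpose_def)
  qed (simp add: sym_group_one)
  have h_descent: "h (descent k m) k = Suc m" if "1 \<le> k" "k \<le> Suc m" "m < n" for k m
    using that(2,3)
  proof (induction m)
    case 0
    then have "k = Suc 0" using that(1) by simp
    then show ?case by (simp add: sym_group_one)
  next
    case (Suc m)
    show ?case
    proof (cases "k = Suc (Suc m)")
      case True
      then show ?thesis by (simp add: sym_group_one)
    next
      case False
      then show ?thesis using Suc that(1) by (simp add: descent_Suc sym_group_mult hv)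
    qed
  qed
  have "\<forall>ks. set ks \<subseteq> {1..<m} \<longrightarrow> h (vprod ks) = id \<longrightarrow> vprod ks = \<one>" if "m \<le> n" for m
    using that
  proof (induction m)
    case (Suc m)
    show ?case
    proof (intro allI impI)
      fix ks assume ks: "set ks \<subseteq> {1..<Suc m}" "h (vprod ks) = id"
      then obtain ls k where ls: "set ls \<subseteq> {1..<m}" and k: "1 \<le> k" "k \<le> Suc m"
        and eq: "vprod ks = vprod ls \<otimes> descent k m"
        using vprod_normal_form[of ks m] Suc.prems by (auto simp: atLeastLessThanSuc_atLeastAtMost)
      have c: "vprod ls \<in> carrier G" "descent k m \<in> carrier G"
        using ls k Suc.prems by (auto intro!: vprod_closed)
      have "k = h (vprod ks) k" using ks(2) by simp
      also have "\<dots> = h (vprod ls) (h (descent k m) k)"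
        by (simp add: eq sym_group_mult c)
      also have "\<dots> = Suc m"
        using h_descent[OF k] h_vprod[OF ls, of "Suc m"] Suc.prems by simp
      finally have "vprod ks = vprod ls" using eq c by simp
      moreover from this have "h (vprod ls) = id" using ks(2) by simp
      ultimately show "vprod ks = \<one>" using Suc.IH[rule_format, OF _ ls] Suc.prems by simp
    qed
  qed simp
  from this[of n] show ?thesis using assms by simp
qed

end


section \<open>The action of the symmetric group on the presented pure group\<close>

abbreviation VP_class :: "nat \<Rightarrow> (nat \<times> nat) gword \<Rightarrow> (nat \<times> nat) gword set" where
  "VP_class n \<equiv> word_class (VP_gens n) (VP_rels n)"

definition PV :: "nat \<Rightarrow> (nat \<times> nat) gword set monoid" where
  "PV n = presented_group (VP_gens n) (VP_rels n)"

text \<open>Taking the image of a class makes the composition law hold without conditions. That the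
  image is again a class is shown in \<open>perm_act_class\<close>.\<close>

definition perm_act :: "(nat \<Rightarrow> nat) \<Rightarrow> (nat \<times> nat) gword set \<Rightarrow> (nat \<times> nat) gword set" where
  "perm_act p A = relabel (map_prod p p) ` A"

lemma PV_group: "group (PV n)"
  by (simp add: PV_def presented_group_is_group)

lemma VP_gens_iff: "(i, j) \<in> VP_gens n \<longleftrightarrow> i \<in> {1..n} \<and> j \<in> {1..n} \<and> i \<noteq> j"
  by (simp add: VP_gens_def)

lemma VP_gens_perm:
  assumes "p permutes {1..n}"
  shows "(p i, p j) \<in> VP_gens n \<longleftrightarrow> (i, j) \<in> VP_gens n"
  using permutes_in_image[OF assms] inj_eq[OF permutes_inj[OF assms]] by (simp add: VP_gens_iff)

lemma VP_rels_gwords: "VP_rels n \<subseteq> gwords (VP_gens n) \<times> gwords (VP_gens n)"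
proof (rule subrelI)
  fix u w assume "(u, w) \<in> VP_rels n"
  then show "(u, w) \<in> gwords (VP_gens n) \<times> gwords (VP_gens n)"
    by cases (simp_all add: VP_gens_iff)
qed

text \<open>The relations are imposed for all admissible indices, with no reference to their order,
  so injectivity of \<open>p\<close> suffices.\<close>

lemma VP_rels_perm:
  assumes p: "p permutes {1..n}" and "(u, w) \<in> VP_rels n"
  shows "(relabel (map_prod p p) u, relabel (map_prod p p) w) \<in> VP_rels n"
  using assms(2)
proof cases
  case (triple i j k)
  then have "p i \<in> {1..n}" "p j \<in> {1..n}" "p k \<in> {1..n}" "distinct [p i, p j, p k]"
    using permutes_in_image[OF p] inj_eq[OF permutes_inj[OF p]] by auto
  then show ?thesis using triple VP_rels.triple by simp
next
  case (commute i j k l)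
  then have "{p i, p j} \<inter> {p k, p l} = {}"
    using inj_eq[OF permutes_inj[OF p]] by auto
  then show ?thesis using commute VP_rels.commute[of "p i" "p j" n "p k" "p l"]
    by (simp add: VP_gens_perm[OF p])
qed

lemma perm_act_class:
  assumes p: "p permutes {1..n}"
  shows "perm_act p (VP_class n u) = VP_class n (relabel (map_prod p p) u)"
  unfolding perm_act_def
proof (rule relabel_class)
  note q = permutes_inv[OF p]
  show "map_prod p p ` VP_gens n \<subseteq> VP_gens n"
    "map_prod (Hilbert_Choice.inv p) (Hilbert_Choice.inv p) ` VP_gens n \<subseteq> VP_gens n"
    using VP_gens_perm[OF p] VP_gens_perm[OF q] by auto
  show "map_prod p p \<circ> map_prod (Hilbert_Choice.inv p) (Hilbert_Choice.inv p) = id" "map_prod (Hilbert_Choice.inv p) (Hilbert_Choice.inv p) \<circ> map_prod p p = id"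
    by (simp_all add: map_prod.comp permutes_inv_o[OF p] map_prod.id)
qed (use VP_rels_perm[OF p] VP_rels_perm[OF permutes_inv[OF p]] in auto)

lemma relabel_perm_gwords:
  "p permutes {1..n} \<Longrightarrow> u \<in> gwords (VP_gens n) \<Longrightarrow> relabel (map_prod p p) u \<in> gwords (VP_gens n)"
  by (rule relabel_gwords) (auto simp: VP_gens_perm)

lemma perm_act_hom:
  assumes "p permutes {1..n}"
  shows "perm_act p \<in> hom (PV n) (PV n)"
  using assms
  by (auto simp: hom_def PV_def presented_carrier presented_mult perm_act_class relabel_perm_gwords)

lemma perm_act_comp: "perm_act (p \<circ> q) A = perm_act p (perm_act q A)"
  by (simp add: perm_act_def image_image flip: relabel_comp map_prod.comp)

lemma perm_act_id: "perm_act id A = A"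
  by (simp add: perm_act_def relabel_def map_prod.id list.map_id)

section \<open>The semidirect product as a model of the virtual braid relations\<close>

definition SD :: "nat \<Rightarrow> ((nat \<times> nat) gword set \<times> (nat \<Rightarrow> nat)) monoid" where
  "SD n = semidirect (PV n) (sym_group n) perm_act"

lemma SD_group: "group (SD n)"
  unfolding SD_def
  by (rule semidirect_group)
    (simp_all add: PV_group sym_group_is_group perm_act_hom perm_act_comp perm_act_id
      sym_group_carrier sym_group_mult sym_group_one)

lemma SD_mult:
  "(A, p) \<otimes>\<^bsub>SD n\<^esub> (B, q) = (A \<otimes>\<^bsub>PV n\<^esub> perm_act p B, p \<circ> q)"
  by (simp add: SD_def sym_group_mult)

lemma SD_one: "\<one>\<^bsub>SD n\<^esub> = (VP_class n [], id)"
  by (simp add: SD_def PV_def presented_one sym_group_one)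

text \<open>The choice is forced: \<open>v i\<close> being an involution, the string
  \<open>s i v i\<close> determines \<open>s i\<close> as that string times
  \<open>v i\<close>.\<close>

definition SD_sig :: "nat \<Rightarrow> nat \<Rightarrow> (nat \<times> nat) gword set \<times> (nat \<Rightarrow> nat)" where
  "SD_sig n i = (VP_class n [ms i (i + 1)], transpose i (i + 1))"

definition SD_vir :: "nat \<Rightarrow> nat \<Rightarrow> (nat \<times> nat) gword set \<times> (nat \<Rightarrow> nat)" where
  "SD_vir n i = (VP_class n [], transpose i (i + 1))"

lemma SD_class_mult:
  assumes "u \<in> gwords (VP_gens n)" "w \<in> gwords (VP_gens n)" "p permutes {1..n}"
  shows "(VP_class n u, p) \<otimes>\<^bsub>SD n\<^esub> (VP_class n w, q)
    = (VP_class n (u @ relabel (map_prod p p) w), p \<circ> q)"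
  using assms by (simp add: SD_mult perm_act_class PV_def presented_mult relabel_perm_gwords)

lemma transpose_Suc_permutes: "1 \<le> i \<Longrightarrow> i < n \<Longrightarrow> transpose i (Suc i) permutes {1..n}"
  by (rule permutes_swap_id) auto

lemma SD_virtual_braid: "virtual_braid (SD n) n (SD_sig n) (SD_vir n)"
proof -
  interpret group "SD n" by (rule SD_group)
  have perm: "transpose i (Suc i) permutes {Suc 0..n}" if "Suc 0 \<le> i" "i < n" for i
    using transpose_Suc_permutes that by simp
  note calc = SD_sig_def SD_vir_def SD_class_mult VP_gens_iff perm
  show ?thesis
  proof unfold_locales
    fix i assume i: "1 \<le> i" "i < n"
    then show "SD_sig n i \<in> carrier (SD n)" "SD_vir n i \<in> carrier (SD n)"
      by (auto simp: SD_def PV_def SD_sig_def SD_vir_def sym_group_carrier VP_gens_iff perm)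
    show "SD_vir n i \<otimes>\<^bsub>SD n\<^esub> SD_vir n i = \<one>\<^bsub>SD n\<^esub>"
      using i by (simp add: calc SD_one)
  next
    fix i assume i: "1 \<le> i" "i + 1 < n"
    have t: "transpose i (Suc i) \<circ> (transpose (Suc i) (Suc (Suc i)) \<circ> transpose i (Suc i))
      = transpose (Suc i) (Suc (Suc i)) \<circ> (transpose i (Suc i) \<circ> transpose (Suc i) (Suc (Suc i)))"
      by (auto simp: transpose_def fun_eq_iff)
    \<comment> \<open>Pushing the transpositions to the right turns the two sides of
      \<open>B1\<close> into these words, so \<open>B1\<close> becomes the triple relation for three
      consecutive indices.\<close>
    have "VP_class n [ms i (Suc i), ms i (Suc (Suc i)), ms (Suc i) (Suc (Suc i))]
      = VP_class n [ms (Suc i) (Suc (Suc i)), ms i (Suc (Suc i)), ms i (Suc i)]"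
      using i by (intro presented_rel VP_rels.triple) (auto simp: VP_gens_iff)
    then show "SD_sig n i \<otimes>\<^bsub>SD n\<^esub> (SD_sig n (i + 1) \<otimes>\<^bsub>SD n\<^esub> SD_sig n i)
      = SD_sig n (i + 1) \<otimes>\<^bsub>SD n\<^esub> (SD_sig n i \<otimes>\<^bsub>SD n\<^esub> SD_sig n (i + 1))"
      using i by (simp add: calc t)
    show "SD_vir n i \<otimes>\<^bsub>SD n\<^esub> (SD_vir n (i + 1) \<otimes>\<^bsub>SD n\<^esub> SD_vir n i)
      = SD_vir n (i + 1) \<otimes>\<^bsub>SD n\<^esub> (SD_vir n i \<otimes>\<^bsub>SD n\<^esub> SD_vir n (i + 1))"
      using i by (simp add: calc t)
    show "SD_vir n i \<otimes>\<^bsub>SD n\<^esub> (SD_sig n (i + 1) \<otimes>\<^bsub>SD n\<^esub> SD_vir n i)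
      = SD_vir n (i + 1) \<otimes>\<^bsub>SD n\<^esub> (SD_sig n i \<otimes>\<^bsub>SD n\<^esub> SD_vir n (i + 1))"
      using i by (simp add: calc t)
  next
    fix i j assume ij: "1 \<le> i" "i < n" "1 \<le> j" "j < n" "i + 1 < j \<or> j + 1 < i"
    have t: "transpose i (Suc i) \<circ> transpose j (Suc j) = transpose j (Suc j) \<circ> transpose i (Suc i)"
      using ij(5) by (auto simp: transpose_def fun_eq_iff)
    have t': "transpose i (Suc i) j = j" "transpose i (Suc i) (Suc j) = Suc j"
      "transpose j (Suc j) i = i" "transpose j (Suc j) (Suc i) = Suc i"
      using ij(5) by (auto simp: transpose_def)
    \<comment> \<open>Likewise \<open>B2\<close> becomes a commutation relation, because the distant
      transpositions fix the other pair of indices.\<close>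
    have "VP_class n [ms i (Suc i), ms j (Suc j)] = VP_class n [ms j (Suc j), ms i (Suc i)]"
      using ij by (intro presented_rel VP_rels.commute) (auto simp: VP_gens_iff)
    then show "SD_sig n i \<otimes>\<^bsub>SD n\<^esub> SD_sig n j = SD_sig n j \<otimes>\<^bsub>SD n\<^esub> SD_sig n i"
      using ij(1-4) by (simp add: calc t t')
    show "SD_vir n i \<otimes>\<^bsub>SD n\<^esub> SD_vir n j = SD_vir n j \<otimes>\<^bsub>SD n\<^esub> SD_vir n i"
      using ij(1-4) by (simp add: calc t)
    show "SD_sig n i \<otimes>\<^bsub>SD n\<^esub> SD_vir n j = SD_vir n j \<otimes>\<^bsub>SD n\<^esub> SD_sig n i"
      using ij(1-4) by (simp add: calc t t')
  qed
qed

interpretation SD: virtual_braid "SD n" n "SD_sig n" "SD_vir n" for n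
  by (rule SD_virtual_braid)

text \<open>Conjugation by \<open>SD_vir n k\<close> acts on the first component as the permutation
  action, so the orbit argument reduces the claim to the string from \<open>1\<close> to
  \<open>2\<close>. Hence the semidirect product recovers the formal generator from its
  string.\<close>

lemma SD_mu_el:
  assumes "(r, s) \<in> VP_gens n"
  shows "SD.mu_el n r s = (VP_class n [ms r s], id)"
proof -
  define Q where "Q = (\<lambda>xs. \<forall>r s. xs = [r, s] \<longrightarrow> SD.mu_el n r s = (VP_class n [ms r s], id))"
  have "Q [r, s]"
  proof (rule distinct_list_orbit[of n 2 Q])
    fix k xs assume *: "1 \<le> k" "k < n" "set xs \<subseteq> {1..n}" "distinct xs" "length xs = 2" "Q xs"
    from *(5) obtain a b where xs: "xs = [a, b]"
      by (auto simp: length_Suc_conv numeral_eq_Suc)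
    have "SD.mu_el n (transpose k (k + 1) a) (transpose k (k + 1) b) = SD.cj n k (SD.mu_el n a b)"
      using *(1-4) by (intro SD.cj_mu_el[symmetric]) (auto simp: xs)
    also have "SD.mu_el n a b = (VP_class n [ms a b], id)"
      using *(6) by (simp add: Q_def xs)
    also have "SD.cj n k \<dots> = (VP_class n [ms (transpose k (k + 1) a) (transpose k (k + 1) b)], id)"
      using *(1-4) transpose_Suc_permutes[of k n]
      by (simp add: SD.cj_def SD_vir_def SD_class_mult VP_gens_iff xs permutes_id)
    finally show "Q (map (transpose k (k + 1)) xs)"
      by (simp add: Q_def xs)
  next
    have "2 \<le> n" using assms by (auto simp: VP_gens_iff)
    then have "SD_sig n 1 \<otimes>\<^bsub>SD n\<^esub> SD_vir n 1 = (VP_class n [ms 1 2], id)"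
      using transpose_Suc_permutes[of 1 n]
      by (simp add: SD_sig_def SD_vir_def SD_class_mult VP_gens_iff numeral_eq_Suc)
    then show "Q [1..<2 + 1]"
      by (simp add: Q_def SD.mu_el_def numeral_eq_Suc)
  qed (use assms in \<open>auto simp: VP_gens_iff\<close>)
  then show ?thesis by (simp add: Q_def)
qed


section \<open>The virtual braid group\<close>

lemma presented_eval:
  assumes "u \<in> gwords X"
  shows "word_eval (presented_group X R) (\<lambda>x. word_class X R [(x, True)]) u = word_class X R u"
  using assms
proof (induction u)
  case (Cons l u)
  then show ?case by (cases l) (simp add: presented_Cons[of _ X u])
qed (simp add: presented_one)

lemma VB_rel_class:
  "(u, w) \<in> VB_rels n \<Longrightarrow> VB_class n u = VB_class n w"
  using VB_rels_gwords by (intro presented_rel) auto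

lemma VB_virtual_braid:
  "virtual_braid (VB n) n (\<lambda>i. VB_class n [sg i]) (\<lambda>i. VB_class n [vr i])"
proof -
  interpret group "VB n" by (rule VB_group)
  have gw: "[sg i] \<in> gwords (VB_gens n)" "[vr i] \<in> gwords (VB_gens n)" if "Suc 0 \<le> i" "i < n" for i
    using that by (auto simp: VB_gens_def)
  note calc = VB_def presented_mult gw
  show ?thesis
  proof unfold_locales
    fix i assume i: "1 \<le> i" "i < n"
    then show "VB_class n [sg i] \<in> carrier (VB n)" "VB_class n [vr i] \<in> carrier (VB n)"
      by (simp_all add: VB_def gw)
    show "VB_class n [vr i] \<otimes>\<^bsub>VB n\<^esub> VB_class n [vr i] = \<one>\<^bsub>VB n\<^esub>"
      using i VB_rel_class[OF VB_rels.S3[of i n]] by (simp add: VB_def presented_mult gw presented_one)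
  next
    fix i assume i: "1 \<le> i" "i + 1 < n"
    show "VB_class n [sg i] \<otimes>\<^bsub>VB n\<^esub> (VB_class n [sg (i + 1)] \<otimes>\<^bsub>VB n\<^esub> VB_class n [sg i])
      = VB_class n [sg (i + 1)] \<otimes>\<^bsub>VB n\<^esub> (VB_class n [sg i] \<otimes>\<^bsub>VB n\<^esub> VB_class n [sg (i + 1)])"
      using i VB_rel_class[OF VB_rels.B1[of i n]] by (simp add: calc)
    show "VB_class n [vr i] \<otimes>\<^bsub>VB n\<^esub> (VB_class n [vr (i + 1)] \<otimes>\<^bsub>VB n\<^esub> VB_class n [vr i])
      = VB_class n [vr (i + 1)] \<otimes>\<^bsub>VB n\<^esub> (VB_class n [vr i] \<otimes>\<^bsub>VB n\<^esub> VB_class n [vr (i + 1)])"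
      using i VB_rel_class[OF VB_rels.S1[of i n]] by (simp add: calc)
    show "VB_class n [vr i] \<otimes>\<^bsub>VB n\<^esub> (VB_class n [sg (i + 1)] \<otimes>\<^bsub>VB n\<^esub> VB_class n [vr i])
      = VB_class n [vr (i + 1)] \<otimes>\<^bsub>VB n\<^esub> (VB_class n [sg i] \<otimes>\<^bsub>VB n\<^esub> VB_class n [vr (i + 1)])"
      using i VB_rel_class[OF VB_rels.M1[of i n]] by (simp add: calc)
  next
    fix i j assume "1 \<le> i" "i < n" "1 \<le> j" "j < n" "i + 1 < j \<or> j + 1 < i"
    then have i: "Suc 0 \<le> i" "i < n" "Suc 0 \<le> j" "j < n" "\<bar>int i - int j\<bar> > 1" by auto
    show "VB_class n [sg i] \<otimes>\<^bsub>VB n\<^esub> VB_class n [sg j]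
      = VB_class n [sg j] \<otimes>\<^bsub>VB n\<^esub> VB_class n [sg i]"
      using i VB_rel_class[OF VB_rels.B2[of i n j]] by (simp add: calc)
    show "VB_class n [vr i] \<otimes>\<^bsub>VB n\<^esub> VB_class n [vr j]
      = VB_class n [vr j] \<otimes>\<^bsub>VB n\<^esub> VB_class n [vr i]"
      using i VB_rel_class[OF VB_rels.S2[of i n j]] by (simp add: calc)
    show "VB_class n [sg i] \<otimes>\<^bsub>VB n\<^esub> VB_class n [vr j]
      = VB_class n [vr j] \<otimes>\<^bsub>VB n\<^esub> VB_class n [sg i]"
      using i VB_rel_class[OF VB_rels.M2[of i n j]] by (simp add: calc)
  qed
qed

interpretation VB: virtual_braid "VB n" n "\<lambda>i. VB_class n [sg i]" "\<lambda>i. VB_class n [vr i]" for n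
  by (rule VB_virtual_braid)

lemma mu_eq_mu_el:
  assumes "(r, s) \<in> VP_gens n"
  shows "mu n (r, s) = VB.mu_el n r s"
proof -
  \<comment> \<open>Inside \<open>VB n\<close> itself the assignment is tautological, so evaluating
    a word returns its class.\<close>
  have "VB.gen n = (\<lambda>x. VB_class n [(x, True)])"
    by (auto simp: fun_eq_iff VB.gen_def split: vb_gen.split)
  then have "word_eval (VB n) (VB.gen n) (mu_word r s) = VB_class n (mu_word r s)"
    using VB.mu_word_gwords[OF assms] by (simp add: VB_def presented_eval)
  then show ?thesis
    using VB.word_eval_mu_word[OF assms] by (simp add: mu_def)
qed

lemma mu_closed: "mu n \<in> VP_gens n \<rightarrow> carrier (VB n)"
  by (auto simp: mu_eq_mu_el VP_gens_iff)

lemma mu_rels: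
  assumes "(u, w) \<in> VP_rels n"
  shows "word_eval (VB n) (mu n) u = word_eval (VB n) (mu n) w"
  using assms
proof cases
  case (triple i j k)
  then have "(i, j) \<in> VP_gens n" "(i, k) \<in> VP_gens n" "(j, k) \<in> VP_gens n"
    by (auto simp: VP_gens_iff)
  then show ?thesis
    using triple VB.mu_el_triple[of i j k n] by (simp add: mu_eq_mu_el VP_gens_iff)
next
  case (commute i j k l)
  then have "VB.mu_el n i j \<otimes>\<^bsub>VB n\<^esub> VB.mu_el n k l = VB.mu_el n k l \<otimes>\<^bsub>VB n\<^esub> VB.mu_el n i j"
    by (intro VB.mu_el_commute) (auto simp: VP_gens_iff)
  then show ?thesis
    using commute by (simp add: mu_eq_mu_el VP_gens_iff)
qed

section \<open>Homomorphisms between the presented group, the virtual braid group and the semidirect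
  product\<close>

definition to_VB :: "nat \<Rightarrow> (nat \<times> nat) gword set \<Rightarrow> vb_gen gword set" where
  "to_VB n = presented_lift (VB n) (mu n)"

lemma to_VB_hom: "to_VB n \<in> hom (PV n) (VB n)"
  unfolding to_VB_def PV_def by (rule VB.presented_lift_hom[OF mu_closed mu_rels])

lemma to_VB_gen: "(r, s) \<in> VP_gens n \<Longrightarrow> to_VB n (VP_class n [ms r s]) = mu n (r, s)"
  unfolding to_VB_def using mu_closed[of n]
  by (subst VB.presented_lift_word_class[OF mu_closed mu_rels]) (auto simp: Pi_iff)

definition to_SD :: "nat \<Rightarrow> vb_gen gword set \<Rightarrow> (nat \<times> nat) gword set \<times> (nat \<Rightarrow> nat)" where
  "to_SD n = presented_lift (SD n) (SD.gen n)"

lemma to_SD_hom: "to_SD n \<in> hom (VB n) (SD n)"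
  unfolding to_SD_def VB_def by (rule SD.presented_lift_hom[OF SD.gen_closed SD.gen_rels])

lemma to_SD_class:
  "u \<in> gwords (VB_gens n) \<Longrightarrow> to_SD n (VB_class n u) = word_eval (SD n) (SD.gen n) u"
  unfolding to_SD_def by (rule SD.presented_lift_word_class[OF SD.gen_closed SD.gen_rels])

lemma to_SD_mu:
  assumes "(r, s) \<in> VP_gens n"
  shows "to_SD n (mu n (r, s)) = (VP_class n [ms r s], id)"
  using SD.word_eval_mu_word[OF assms] SD.mu_word_gwords[OF assms] SD_mu_el[OF assms]
  by (simp add: mu_def to_SD_class)

text \<open>Both sides are homomorphisms that agree on the generators by \<open>to_SD_mu\<close>.
  This is what makes \<open>to_VB\<close> injective.\<close>

lemma to_SD_to_VB:
  assumes "a \<in> carrier (PV n)"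
  shows "to_SD n (to_VB n a) = (a, id)"
proof -
  have "(to_SD n \<circ> to_VB n) a = (\<lambda>a. (a, id)) a"
  proof (rule SD.presented_hom_eqI)
    show "to_SD n \<circ> to_VB n \<in> hom (presented_group (VP_gens n) (VP_rels n)) (SD n)"
      using hom_compose[OF to_VB_hom to_SD_hom] by (simp add: PV_def)
    show "(\<lambda>a. (a, id)) \<in> hom (presented_group (VP_gens n) (VP_rels n)) (SD n)"
      unfolding PV_def[symmetric]
      by (rule homI) (simp_all add: SD_def perm_act_id sym_group_mult sym_group_carrier permutes_id)
    fix x assume "x \<in> VP_gens n"
    then show "(to_SD n \<circ> to_VB n) (VP_class n [(x, True)]) = (VP_class n [(x, True)], id)"
      by (cases x) (simp add: to_VB_gen to_SD_mu)
  qed (use assms in \<open>simp add: PV_def\<close>)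
  then show ?thesis by simp
qed

text \<open>Together with \<open>to_SD_to_VB\<close> this shows that the image of
  \<open>to_VB\<close> consists of pure elements.\<close>

lemma snd_to_SD:
  assumes "x \<in> carrier (VB n)"
  shows "snd (to_SD n x) = VB_perm n x"
proof -
  have snd: "snd \<in> hom (SD n) (sym_group n)"
    by (auto simp: hom_def SD_def)
  have "(snd \<circ> to_SD n) x = VB_perm n x"
  proof (rule group.presented_hom_eqI[OF sym_group_is_group])
    show "snd \<circ> to_SD n \<in> hom (presented_group (VB_gens n) (VB_rels n)) (sym_group n)"
      using hom_compose[OF to_SD_hom snd] by (simp add: VB_def)
    show "VB_perm n \<in> hom (presented_group (VB_gens n) (VB_rels n)) (sym_group n)"
      using VB_perm_hom by (simp add: VB_def)
    fix g assume "g \<in> VB_gens n"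
    then show "(snd \<circ> to_SD n) (VB_class n [(g, True)]) = VB_perm n (VB_class n [(g, True)])"
      by (cases g) (simp_all add: to_SD_class VB_perm_gen SD_sig_def SD_vir_def SD_one SD_mult)
  qed (use assms in \<open>simp add: VB_def\<close>)
  then show ?thesis by simp
qed

text \<open>The equivariance \<open>cj_mu_el\<close> extended from generators to all elements. It
  lets a virtual generator be moved past the image of \<open>to_VB\<close>.\<close>

lemma cj_to_VB:
  assumes "1 \<le> k" "k < n" "a \<in> carrier (PV n)"
  shows "VB.cj n k (to_VB n a) = to_VB n (perm_act (transpose k (k + 1)) a)"
proof -
  have p: "transpose k (k + 1) permutes {1..n}"
    using transpose_Suc_permutes assms by simp
  have cj: "VB.cj n k \<in> hom (VB n) (VB n)"
    using assms by (auto simp: hom_def VB.cj_mult)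
  have "(VB.cj n k \<circ> to_VB n) a = (to_VB n \<circ> perm_act (transpose k (k + 1))) a"
  proof (rule VB.presented_hom_eqI[where n = n and X = "VP_gens n" and R = "VP_rels n"])
    show "VB.cj n k \<circ> to_VB n \<in> hom (presented_group (VP_gens n) (VP_rels n)) (VB n)"
      using hom_compose[OF to_VB_hom cj] by (simp add: PV_def)
    show "to_VB n \<circ> perm_act (transpose k (k + 1)) \<in> hom (presented_group (VP_gens n) (VP_rels n)) (VB n)"
      using hom_compose[OF perm_act_hom[OF p] to_VB_hom] by (simp add: PV_def)
    fix x assume x: "x \<in> VP_gens n"
    obtain i j where ij: "x = (i, j)" by force
    have g: "(transpose k (k + 1) i, transpose k (k + 1) j) \<in> VP_gens n"
      using x ij VP_gens_perm[OF p] by simp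
    have "VB.cj n k (VB.mu_el n i j) = VB.mu_el n (transpose k (k + 1) i) (transpose k (k + 1) j)"
      using x assms by (intro VB.cj_mu_el) (auto simp: ij VP_gens_iff)
    then show "(VB.cj n k \<circ> to_VB n) (VP_class n [(x, True)])
      = (to_VB n \<circ> perm_act (transpose k (k + 1))) (VP_class n [(x, True)])"
      using x g by (simp add: ij to_VB_gen perm_act_class[OF p, simplified] mu_eq_mu_el)
  qed (use assms in \<open>simp add: PV_def\<close>)
  then show ?thesis by simp
qed

text \<open>The set \<open>D\<close> of such products contains the identity and is closed under left
  multiplication by strings, their inverses and virtual generators. As \<open>s k\<close> is a
  string times \<open>v k\<close>, induction on words shows that \<open>D\<close> is
  everything.\<close>

lemma VB_decompose:
  assumes "x \<in> carrier (VB n)"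
  shows "\<exists>a ks. a \<in> carrier (PV n) \<and> set ks \<subseteq> {1..<n} \<and> x = to_VB n a \<otimes>\<^bsub>VB n\<^esub> VB.vprod n ks"
proof -
  interpret PV: group "PV n" by (rule PV_group)
  interpret \<phi>: group_hom "PV n" "VB n" "to_VB n"
    using to_VB_hom by unfold_locales
  let ?v = "\<lambda>k. VB_class n [vr k]" and ?s = "\<lambda>k. VB_class n [sg k]"
  define D where "D = {to_VB n a \<otimes>\<^bsub>VB n\<^esub> VB.vprod n ks | a ks. a \<in> carrier (PV n) \<and> set ks \<subseteq> {1..<n}}"
  have D_closed: "y \<in> carrier (VB n)" if "y \<in> D" for y
    using that by (auto simp: D_def)
  have mult: "to_VB n b \<otimes>\<^bsub>VB n\<^esub> y \<in> D" if b: "b \<in> carrier (PV n)" and yD: "y \<in> D" for b y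
  proof -
    obtain a ks where "a \<in> carrier (PV n)" "set ks \<subseteq> {1..<n}"
      and y: "y = to_VB n a \<otimes>\<^bsub>VB n\<^esub> VB.vprod n ks"
      using yD by (auto simp: D_def)
    moreover from this have "to_VB n b \<otimes>\<^bsub>VB n\<^esub> y = to_VB n (b \<otimes>\<^bsub>PV n\<^esub> a) \<otimes>\<^bsub>VB n\<^esub> VB.vprod n ks"
      using b by (simp add: VB.m_assoc)
    moreover have "b \<otimes>\<^bsub>PV n\<^esub> a \<in> carrier (PV n)" using calculation b by simp
    ultimately show ?thesis unfolding D_def by blast
  qed
  have vir: "?v k \<otimes>\<^bsub>VB n\<^esub> y \<in> D" if k: "1 \<le> k" "k < n" and yD: "y \<in> D" for k y
  proof -
    obtain a ks where a: "a \<in> carrier (PV n)" and ks: "set ks \<subseteq> {1..<n}"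
      and y: "y = to_VB n a \<otimes>\<^bsub>VB n\<^esub> VB.vprod n ks"
      using yD by (auto simp: D_def)
    \<comment> \<open>Inserting \<open>v k \<otimes> v k = \<one>\<close> behind the first factor
      turns it into a conjugate and lengthens the virtual word by \<open>k\<close>.\<close>
    have "?v k \<otimes>\<^bsub>VB n\<^esub> y = VB.cj n k (to_VB n a) \<otimes>\<^bsub>VB n\<^esub> VB.vprod n (k # ks)"
      using k a ks by (simp add: y VB.cj_def VB.m_assoc VB.v_cancel)
    also have "\<dots> = to_VB n (perm_act (transpose k (k + 1)) a) \<otimes>\<^bsub>VB n\<^esub> VB.vprod n (k # ks)"
      by (simp only: cj_to_VB[OF k a])
    finally have "?v k \<otimes>\<^bsub>VB n\<^esub> y = to_VB n (perm_act (transpose k (k + 1)) a) \<otimes>\<^bsub>VB n\<^esub> VB.vprod n (k # ks)" .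
    moreover have "perm_act (transpose k (k + 1)) a \<in> carrier (PV n)"
      using hom_in_carrier[OF perm_act_hom a, of "transpose k (k + 1)"] transpose_Suc_permutes[OF k]
      by simp
    moreover have "set (k # ks) \<subseteq> {1..<n}" using k ks by simp
    ultimately show ?thesis unfolding D_def by blast
  qed
  have D: "VB_class n u \<in> D" if "u \<in> gwords (VB_gens n)" for u
    using that
  proof (induction u)
    case Nil
    have "\<one>\<^bsub>VB n\<^esub> = to_VB n \<one>\<^bsub>PV n\<^esub> \<otimes>\<^bsub>VB n\<^esub> VB.vprod n []" by simp
    moreover have "set [] \<subseteq> {1..<n}" by simp
    ultimately have "\<one>\<^bsub>VB n\<^esub> \<in> D" unfolding D_def using PV.one_closed by blast
    then show ?case by (simp add: VB_def presented_one)
  next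
    case (Cons l u)
    obtain g b where l: "l = (g, b)" by force
    with Cons have u: "VB_class n u \<in> D" "u \<in> gwords (VB_gens n)" and g: "g \<in> VB_gens n" by auto
    have eq: "VB_class n (l # u)
      = (if b then VB_class n [(g, True)] else inv\<^bsub>VB n\<^esub> VB_class n [(g, True)]) \<otimes>\<^bsub>VB n\<^esub> VB_class n u"
      using presented_Cons[OF g u(2)] by (simp add: l VB_def)
    show ?case
    proof (cases g)
      case (Vir k)
      then have k: "1 \<le> k" "k < n" using g by auto
      have "inv\<^bsub>VB n\<^esub> ?v k = ?v k"
        using k by (intro VB.inv_equality VB.S3) auto
      then show ?thesis using vir[OF k u(1)] eq by (simp add: Vir)
    next
      case (Sig k)
      then have k: "1 \<le> k" "k < n" using g by auto
      let ?m = "VP_class n [ms k (k + 1)]"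
      have gk: "(k, k + 1) \<in> VP_gens n" using k by (simp add: VP_gens_iff)
      then have m: "?m \<in> carrier (PV n)" by (simp add: PV_def)
      have "to_VB n ?m = ?s k \<otimes>\<^bsub>VB n\<^esub> ?v k"
        using to_VB_gen[OF gk] mu_eq_mu_el[OF gk] by (simp add: VB.mu_el_def)
      then have s: "?s k = to_VB n ?m \<otimes>\<^bsub>VB n\<^esub> ?v k"
        using k by (simp add: VB.m_assoc VB.S3)
      have "inv\<^bsub>VB n\<^esub> ?v k = ?v k"
        using k by (intro VB.inv_equality VB.S3) auto
      \<comment> \<open>Inversion swaps the factors: here the virtual generator stands in front of
        the inverse string, so the two closure properties are used in the opposite order.\<close>
      then have si: "inv\<^bsub>VB n\<^esub> ?s k = ?v k \<otimes>\<^bsub>VB n\<^esub> to_VB n (inv\<^bsub>PV n\<^esub> ?m)"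
        unfolding s using k m by (simp add: VB.inv_mult_group)
      have "?s k \<otimes>\<^bsub>VB n\<^esub> VB_class n u = to_VB n ?m \<otimes>\<^bsub>VB n\<^esub> (?v k \<otimes>\<^bsub>VB n\<^esub> VB_class n u)"
        unfolding s using k m D_closed[OF u(1)] by (simp add: VB.m_assoc)
      then have 1: "?s k \<otimes>\<^bsub>VB n\<^esub> VB_class n u \<in> D"
        using mult[OF m vir[OF k u(1)]] by simp
      have "inv\<^bsub>VB n\<^esub> ?s k \<otimes>\<^bsub>VB n\<^esub> VB_class n u
        = ?v k \<otimes>\<^bsub>VB n\<^esub> (to_VB n (inv\<^bsub>PV n\<^esub> ?m) \<otimes>\<^bsub>VB n\<^esub> VB_class n u)"
        unfolding si using k m D_closed[OF u(1)] by (simp add: VB.m_assoc)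
      then have 2: "inv\<^bsub>VB n\<^esub> ?s k \<otimes>\<^bsub>VB n\<^esub> VB_class n u \<in> D"
        using vir[OF k mult[OF PV.inv_closed[OF m] u(1)]] by simp
      show ?thesis using 1 2 eq by (simp add: Sig)
    qed
  qed
  from assms obtain u where "u \<in> gwords (VB_gens n)" "x = VB_class n u"
    by (auto simp: VB_def presented_carrier)
  then show ?thesis using D[of u] unfolding D_def by blast
qed

section \<open>The image of \<open>to_VB\<close> and the isomorphism onto the pure group\<close>

lemma VB_perm_to_VB: "a \<in> carrier (PV n) \<Longrightarrow> VB_perm n (to_VB n a) = id"
  using snd_to_SD[of "to_VB n a" n] to_SD_to_VB[of a n] hom_in_carrier[OF to_VB_hom, of a n] by simp

text \<open>In the decomposition of a pure element the string part is pure, so the virtual word has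
  trivial permutation and vanishes by \<open>vprod_eq_one\<close>.\<close>

lemma to_VB_surj:
  assumes "x \<in> carrier (VP n)"
  shows "\<exists>a \<in> carrier (PV n). to_VB n a = x"
proof -
  have x: "x \<in> carrier (VB n)" "VB_perm n x = id"
    using assms by (auto simp: VP_def kernel_def sym_group_one)
  obtain a ks where a: "a \<in> carrier (PV n)" and ks: "set ks \<subseteq> {1..<n}"
    and eq: "x = to_VB n a \<otimes>\<^bsub>VB n\<^esub> VB.vprod n ks"
    using VB_decompose[OF x(1)] by blast
  have c: "to_VB n a \<in> carrier (VB n)" using hom_in_carrier[OF to_VB_hom a] .
  have "VB_perm n x = VB_perm n (to_VB n a) \<circ> VB_perm n (VB.vprod n ks)"
    using hom_mult[OF VB_perm_hom c VB.vprod_closed[OF ks]] by (simp add: eq sym_group_mult)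
  then have "VB_perm n (VB.vprod n ks) = id"
    using x(2) VB_perm_to_VB[OF a] by simp
  then have "VB.vprod n ks = \<one>\<^bsub>VB n\<^esub>"
    using VB.vprod_eq_one[OF VB_perm_hom _ ks] VB_perm_gen(2) by simp
  then show ?thesis using a c by (auto simp: eq)
qed

theorem theorem2:
  fixes n :: nat
  assumes "n \<ge> 2"
  shows "has_presentation (VP n) (VP_gens n) (mu n) (VP_rels n)"
proof -
  have VP: "carrier (VP n) = {x \<in> carrier (VB n). VB_perm n x = id}"
    by (simp add: VP_def kernel_def sym_group_one)
  have hom: "to_VB n \<in> hom (PV n) (VP n)"
    using to_VB_hom[of n] VB_perm_to_VB[of _ n] by (auto simp: hom_def VP) (simp_all add: VP_def)
  \<comment> \<open>The first component of \<open>to_SD n\<close> is a left inverse.\<close>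
  moreover have "inj_on (to_VB n) (carrier (PV n))"
    by (rule inj_onI) (metis to_SD_to_VB prod.inject)
  moreover have "to_VB n ` carrier (PV n) = carrier (VP n)"
    using hom to_VB_surj[of _ n] by (auto simp: hom_def)
  ultimately have "to_VB n \<in> iso (presented_group (VP_gens n) (VP_rels n)) (VP n)"
    by (simp add: iso_def bij_betw_def PV_def)
  then show ?thesis
    unfolding has_presentation_def using VP_group VP_rels_gwords
    by (auto intro!: bexI[of _ "to_VB n"] simp: to_VB_gen)
qed

end
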